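(* Let $G$ be a finite non-cyclic nilpotent group with distinct Sylow subgroups $G_1,G_2,\dots,G_m$. Then: (i) if at least two of the $G_i$ are non-cyclic, then $\Delta_D(G)^*$ is connected; (ii) if $G_i$ is non-cyclic for exactly one index $i$, then $\Delta_D(G)^*$ is connected if and only if $\Delta_D(G_i)^*$ is connected.
   Context: For a finite group $G$, let $M(G)$ denote its Schur multiplier. A Schur cover of $G$ is a group $\tilde{G}$ with a central extension $\{e\}\to M(G)\xrightarrow{\iota}\tilde{G}\xrightarrow{\pi}G\to\{e\}$ such that $\iota(M(G))\subseteq Z(\tilde{G})\cap[\tilde{G},\tilde{G}]$ and $\tilde G$ has maximal order among such extensions. The deep commuting graph $\Delta_D(G)$ is the simple graph with vertex set $G$ in which two distinct vertices are adjacent if and only if their preimages under $\pi$ commute in $\tilde{G}$. A vertex of a graph $\Gamma$ is dominant if it is adjacent to all other vertices. The reduced graph $\Gamma^*$ is the subgraph of $\Gamma$ induced by the set of non-dominant vertices. *)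

theory Defs
  imports "HOL-Algebra.Algebra" "HOL-Computational_Algebra.Primes"
begin

definition grp_center :: "('a, 'm) monoid_scheme \<Rightarrow> 'a set" where
  "grp_center H = {z \<in> carrier H. \<forall>x \<in> carrier H. z \<otimes>\<^bsub>H\<^esub> x = x \<otimes>\<^bsub>H\<^esub> z}"

(* Lower central series: gamma_1 = G (index 0 here), gamma_{k+1} = [gamma_k, G] *)
fun lower_central :: "('a, 'm) monoid_scheme \<Rightarrow> nat \<Rightarrow> 'a set" where
  "lower_central G 0 = carrier G"
| "lower_central G (Suc n) = generate G
     (\<Union>x \<in> lower_central G n. \<Union>y \<in> carrier G.
        {x \<otimes>\<^bsub>G\<^esub> y \<otimes>\<^bsub>G\<^esub> inv\<^bsub>G\<^esub> x \<otimes>\<^bsub>G\<^esub> inv\<^bsub>G\<^esub> y})"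

definition nilpotent_group :: "('a, 'm) monoid_scheme \<Rightarrow> bool" where
  "nilpotent_group G \<longleftrightarrow> group G \<and> (\<exists>n. lower_central G n = {\<one>\<^bsub>G\<^esub>})"

definition sylow_subgroup :: "('a, 'm) monoid_scheme \<Rightarrow> 'a set \<Rightarrow> bool" where
  "sylow_subgroup G P \<longleftrightarrow> (\<exists>p::nat. Factorial_Ring.prime p \<and> p dvd order G \<and> subgroup P G \<and>
      card P = p ^ multiplicity p (order G))"

definition stem_extension :: "('a, 'm) monoid_scheme \<Rightarrow> ('b, 'n) monoid_scheme \<Rightarrow> ('b \<Rightarrow> 'a) \<Rightarrow> bool" where
  "stem_extension G H \<pi> \<longleftrightarrow> group H \<and> \<pi> \<in> hom H G \<and> \<pi> ` carrier H = carrier G \<and>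
      kernel H G \<pi> \<subseteq> grp_center H \<inter> derived H (carrier H)"

(* Schur cover: a finite stem extension of maximal order among all stem extensions of G.
   Competitors are taken with carrier in type nat, which loses nothing since every
   stem extension of a finite group is finite (hence isomorphic to one on nat). *)
definition schur_cover :: "('a, 'm) monoid_scheme \<Rightarrow> ('b, 'n) monoid_scheme \<Rightarrow> ('b \<Rightarrow> 'a) \<Rightarrow> bool" where
  "schur_cover G H \<pi> \<longleftrightarrow> stem_extension G H \<pi> \<and> finite (carrier H) \<and>
      (\<forall>(H'::nat monoid) (\<pi>'::nat \<Rightarrow> 'a). stem_extension G H' \<pi>' \<longrightarrow>
          card (carrier H') \<le> card (carrier H))"

definition deep_adj :: "('b, 'n) monoid_scheme \<Rightarrow> ('b \<Rightarrow> 'a) \<Rightarrow> 'a \<Rightarrow> 'a \<Rightarrow> bool" where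
  "deep_adj H \<pi> x y \<longleftrightarrow> x \<noteq> y \<and>
     (\<forall>a \<in> carrier H. \<forall>b \<in> carrier H. \<pi> a = x \<longrightarrow> \<pi> b = y \<longrightarrow>
        a \<otimes>\<^bsub>H\<^esub> b = b \<otimes>\<^bsub>H\<^esub> a)"

(* Graphs given by a vertex set V and a symmetric irreflexive adjacency relation E *)
definition dominant :: "'a set \<Rightarrow> ('a \<Rightarrow> 'a \<Rightarrow> bool) \<Rightarrow> 'a \<Rightarrow> bool" where
  "dominant V E v \<longleftrightarrow> v \<in> V \<and> (\<forall>w \<in> V. w \<noteq> v \<longrightarrow> E v w)"

definition reduced_vertices :: "'a set \<Rightarrow> ('a \<Rightarrow> 'a \<Rightarrow> bool) \<Rightarrow> 'a set" where
  "reduced_vertices V E = {v \<in> V. \<not> dominant V E v}"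

definition graph_connected :: "'a set \<Rightarrow> ('a \<Rightarrow> 'a \<Rightarrow> bool) \<Rightarrow> bool" where
  "graph_connected V E \<longleftrightarrow>
     (\<forall>u \<in> V. \<forall>v \<in> V. (\<lambda>x y. x \<in> V \<and> y \<in> V \<and> E x y)\<^sup>*\<^sup>* u v)"

definition reduced_connected :: "'a set \<Rightarrow> ('a \<Rightarrow> 'a \<Rightarrow> bool) \<Rightarrow> bool" where
  "reduced_connected V E \<longleftrightarrow> graph_connected (reduced_vertices V E) E"

end

theory Submission
  imports Defs
begin

text \<open>
  Finite nilpotency enters only through the fact that elements of coprime order commute; this passes
  to central extensions, hence to the Schur cover. Writing two lifts as commuting products
  of elements of coprime order reduces commutation in the cover to commutation of the primary parts.

  The key point is that commutation in a Schur cover is universal: if lifts of two elements commute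
  in a Schur cover $H$ of $G$, then they commute in every finite central extension $L$ of $G$.
  Otherwise the fibre product of $H$ and $L$ over $G$ is a central extension whose kernel meets the
  derived subgroup in a set larger than the kernel of $H$, and by successively adjoining roots
  this intersection can be realised inside the kernel of a stem extension, contradicting maximality.
  Applied to pullbacks along a retraction of $G$ onto a Sylow subgroup, this compares
  the cover of $G$ with that of the Sylow subgroup, and it shows that a noncyclic Sylow subgroup
  has noncentral lifts, since a noncyclic abelian $p$-group has a nonabelian central extension.
\<close>

section \<open>Commutators and central extensions\<close>

text \<open>A kernel element \<open>a\<close> outside the derived subgroup cannot simply be factored
  out: some of its powers may lie in the derived subgroup and would be lost. Restricting to the
  kernel of a character \<psi> with \<psi> a nonzero may lose surjectivity onto \<open>G\<close>.
  The remedy in \<open>kernel_reduction\<close> is to attach an integer coordinate to \<psi> and to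
  factor out (a, \<psi> a). Its nontrivial powers have nonzero integer coordinate, so no element of
  the derived subgroup dies. A power of \<open>a\<close> with character value 0 becomes a power of
  the new central element (1, n); this is the root that is adjoined.

  Maximality of a Schur cover thus enters as a numerical bound: in every finite central extension of
  \<open>G\<close>, the kernel meets the derived subgroup in at most as many elements as the kernel
  of the cover has.

  Sylow subgroups are handled through retractions of \<open>G\<close>, which are power maps, rather
  than through a direct product decomposition. \<open>coprime_commute\<close> speaks of annihilating
  exponents instead of orders because exponents pass to homomorphic images unchanged.\<close>

definition coprime_commute :: "('a, 'm) monoid_scheme \<Rightarrow> bool" where
  "coprime_commute G \<longleftrightarrow> (\<forall>x \<in> carrier G. \<forall>y \<in> carrier G. \<forall>(m::nat) (n::nat).
     coprime m n \<longrightarrow> x [^]\<^bsub>G\<^esub> m = \<one>\<^bsub>G\<^esub> \<longrightarrow> y [^]\<^bsub>G\<^esub> n = \<one>\<^bsub>G\<^esub> \<longrightarrow>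
     x \<otimes>\<^bsub>G\<^esub> y = y \<otimes>\<^bsub>G\<^esub> x)"

definition central_extension ::
    "('a, 'm) monoid_scheme \<Rightarrow> ('b, 'n) monoid_scheme \<Rightarrow> ('b \<Rightarrow> 'a) \<Rightarrow> bool" where
  "central_extension G L \<rho> \<longleftrightarrow> group L \<and> \<rho> \<in> hom L G \<and> \<rho> ` carrier L = carrier G \<and>
     kernel L G \<rho> \<subseteq> grp_center L"

lemma coprime_commuteI:
  assumes "\<And>x y m n. x \<in> carrier G \<Longrightarrow> y \<in> carrier G \<Longrightarrow> coprime m (n::nat) \<Longrightarrow>
    x [^]\<^bsub>G\<^esub> m = \<one>\<^bsub>G\<^esub> \<Longrightarrow> y [^]\<^bsub>G\<^esub> n = \<one>\<^bsub>G\<^esub> \<Longrightarrow> x \<otimes>\<^bsub>G\<^esub> y = y \<otimes>\<^bsub>G\<^esub> x"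
  shows "coprime_commute G"
  using assms unfolding coprime_commute_def by blast

lemma coprime_commuteD:
  assumes "coprime_commute G" "x \<in> carrier G" "y \<in> carrier G" "coprime m (n::nat)"
    "x [^]\<^bsub>G\<^esub> m = \<one>\<^bsub>G\<^esub>" "y [^]\<^bsub>G\<^esub> n = \<one>\<^bsub>G\<^esub>"
  shows "x \<otimes>\<^bsub>G\<^esub> y = y \<otimes>\<^bsub>G\<^esub> x"
  using assms unfolding coprime_commute_def by blast

lemma (in group) coprime_pow_eq_one:
  assumes "x \<in> carrier G" "x [^] m = \<one>" "x [^] n = \<one>" "coprime m (n::nat)"
  shows "x = \<one>"
proof -
  have "ord x dvd m" "ord x dvd n" using assms pow_eq_id by auto
  then have "ord x dvd 1" using assms(4) by (meson coprime_common_divisor)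
  then show ?thesis using ord_eq_1 assms(1) by simp
qed

text \<open>Bezout. This replaces splitting an element into primary parts: membership in a centre or
  a centralizer is decided on two coprime powers of the element.\<close>

lemma (in group) subgroup_coprime_pow:
  assumes "subgroup Z G" "a \<in> carrier G" "a [^] m \<in> Z" "a [^] n \<in> Z" "coprime m (n::nat)"
  shows "a \<in> Z"
proof -
  obtain u v :: int where uv: "u * int m + v * int n = 1"
    using bezout_int[of "int m" "int n"] assms(5) by (auto simp: coprime_int_iff)
  have "a [^] (int m * u) = (a [^] m) [^] u" "a [^] (int n * v) = (a [^] n) [^] v"
    using assms(2) int_pow_pow[of a "int m" u] int_pow_pow[of a "int n" v]
    by (simp_all add: int_pow_int)
  then have "a [^] (int m * u) \<in> Z" "a [^] (int n * v) \<in> Z"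
    using subgroup_int_pow_closed[OF assms(1)] assms(3,4) by simp_all
  then have "a [^] (int m * u + int n * v) \<in> Z"
    using assms(2) int_pow_mult subgroup.m_closed[OF assms(1)] by metis
  then show ?thesis using uv assms(2) by (simp add: mult.commute)
qed

lemma (in group) commute_inv:
  assumes "x \<in> carrier G" "y \<in> carrier G" "x \<otimes> y = y \<otimes> x"
  shows "inv x \<otimes> y = y \<otimes> inv x"
proof -
  have "inv x \<otimes> y = inv x \<otimes> (y \<otimes> x) \<otimes> inv x" using assms(1,2) by (simp add: m_assoc)
  also have "\<dots> = inv x \<otimes> (x \<otimes> y) \<otimes> inv x" using assms(3) by simp
  also have "\<dots> = y \<otimes> inv x" using assms(1,2) by (simp flip: m_assoc)
  finally show ?thesis .
qed

lemma (in group) commute_mult: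
  assumes "a \<in> carrier G" "b \<in> carrier G" "y \<in> carrier G" "a \<otimes> y = y \<otimes> a" "b \<otimes> y = y \<otimes> b"
  shows "a \<otimes> b \<otimes> y = y \<otimes> (a \<otimes> b)"
proof -
  have "a \<otimes> b \<otimes> y = a \<otimes> y \<otimes> b" using assms(1-3,5) by (simp add: m_assoc)
  then show ?thesis using assms(1-4) by (simp add: m_assoc)
qed

lemma (in group) centralizer_subgroup:
  assumes "y \<in> carrier G"
  shows "subgroup {x \<in> carrier G. x \<otimes> y = y \<otimes> x} G"
proof (rule subgroupI)
  show "{x \<in> carrier G. x \<otimes> y = y \<otimes> x} \<noteq> {}" using assms by blast
qed (simp_all add: assms commute_inv commute_mult subset_iff)

lemma (in group) center_subgroup: "subgroup (grp_center G) G"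
proof -
  have "grp_center G = (\<Inter>y \<in> carrier G. {x \<in> carrier G. x \<otimes> y = y \<otimes> x})"
    unfolding grp_center_def by blast
  also have "subgroup \<dots> G"
    using subgroups_Inter[of "(\<lambda>y. {x \<in> carrier G. x \<otimes> y = y \<otimes> x}) ` carrier G"]
      centralizer_subgroup by blast
  finally show ?thesis .
qed

text \<open>Moving \<open>y\<close> to the left past one factor \<open>x\<close> costs one factor
  \<open>c\<close>.\<close>

lemma (in group) central_commutator_pow:
  assumes G: "x \<in> carrier G" "y \<in> carrier G" "c \<in> carrier G"
    and c: "x \<otimes> y = c \<otimes> (y \<otimes> x)" and cx: "c \<otimes> x = x \<otimes> c"
  shows "x [^] (i::nat) \<otimes> y = c [^] i \<otimes> (y \<otimes> x [^] i)"
proof (induction i)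
  case (Suc i)
  have "x [^] Suc i \<otimes> y = x [^] i \<otimes> (x \<otimes> y)"
    using G by (simp add: m_assoc)
  also have "\<dots> = x [^] i \<otimes> c \<otimes> (y \<otimes> x)" using G c by (simp add: m_assoc)
  also have "x [^] i \<otimes> c = c \<otimes> x [^] i" using group_commutes_pow[of x c i] cx G by simp
  also have "c \<otimes> x [^] i \<otimes> (y \<otimes> x) = c \<otimes> (x [^] i \<otimes> y) \<otimes> x" using G by (simp add: m_assoc)
  also have "\<dots> = (c \<otimes> c [^] i) \<otimes> (y \<otimes> (x [^] i \<otimes> x))" using G Suc by (simp add: m_assoc)
  also have "c \<otimes> c [^] i = c [^] Suc i" using G by (metis nat_pow_Suc2)
  finally show ?case using G by simp
qed (use G in simp)

text \<open>\<open>c\<close> is the commutator of \<open>x\<close> and \<open>y\<close>. From x^m =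
  1 follows c^m = 1; exchanging the two elements inverts \<open>c\<close>, so y^n = 1 gives c^n = 1.
  Coprimality leaves c = 1.\<close>

lemma (in group) central_commutator_coprime:
  assumes G: "x \<in> carrier G" "y \<in> carrier G" "c \<in> carrier G"
    and c: "x \<otimes> y = c \<otimes> (y \<otimes> x)" and cx: "c \<otimes> x = x \<otimes> c" and cy: "c \<otimes> y = y \<otimes> c"
    and mn: "x [^] m = \<one>" "y [^] n = \<one>" "coprime m (n::nat)"
  shows "x \<otimes> y = y \<otimes> x"
proof -
  have m: "c [^] m = \<one>"
    using central_commutator_pow[OF G c cx, of m] mn G by (metis l_one nat_pow_closed r_cancel_one' r_one)
  have "y \<otimes> x = inv c \<otimes> (x \<otimes> y)" using G c by (simp add: inv_solve_left)
  then have "y [^] n \<otimes> x = inv c [^] n \<otimes> (x \<otimes> y [^] n)"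
    using central_commutator_pow[of y x "inv c" n] commute_inv[of c y] G cy by simp
  then have "inv c [^] n = \<one>" using mn G by (metis inv_closed l_one nat_pow_closed r_cancel_one' r_one)
  then have n: "c [^] n = \<one>" using G by (metis inv_eq_1_iff nat_pow_closed nat_pow_inv)
  show ?thesis using coprime_pow_eq_one[OF G(3) m n mn(3)] c G by simp
qed

lemma (in group) commutator_one_iff:
  assumes "x \<in> carrier G" "y \<in> carrier G"
  shows "x \<otimes> y \<otimes> inv x \<otimes> inv y = \<one> \<longleftrightarrow> x \<otimes> y = y \<otimes> x"
proof -
  have "x \<otimes> y \<otimes> inv x \<otimes> inv y = (x \<otimes> y) \<otimes> inv (y \<otimes> x)"
    using assms by (simp add: m_assoc inv_mult_group)
  then show ?thesis using assms inv_solve_right'[of \<one> "x \<otimes> y" "y \<otimes> x"] by auto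
qed

lemma (in group) mult_eq_commutator_mult:
  assumes "x \<in> carrier G" "y \<in> carrier G"
  shows "x \<otimes> y = x \<otimes> y \<otimes> inv x \<otimes> inv y \<otimes> (y \<otimes> x)"
proof -
  have "x \<otimes> y \<otimes> inv x \<otimes> inv y = (x \<otimes> y) \<otimes> inv (y \<otimes> x)"
    using assms by (simp add: m_assoc inv_mult_group)
  then show ?thesis using assms m_assoc[of "x \<otimes> y" "inv (y \<otimes> x)" "y \<otimes> x"] by simp
qed

lemma central_extension_hom:
  assumes "group G" "central_extension G L \<rho>"
  shows "group_hom L G \<rho>"
  using assms by (simp add: central_extension_def group_hom_def group_hom_axioms_def)

lemma central_extension_commutator_kernel:
  assumes "group G" "central_extension G L \<rho>" "x \<in> carrier L" "y \<in> carrier L"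
    "\<rho> x \<otimes>\<^bsub>G\<^esub> \<rho> y = \<rho> y \<otimes>\<^bsub>G\<^esub> \<rho> x"
  shows "x \<otimes>\<^bsub>L\<^esub> y \<otimes>\<^bsub>L\<^esub> inv\<^bsub>L\<^esub> x \<otimes>\<^bsub>L\<^esub> inv\<^bsub>L\<^esub> y \<in> kernel L G \<rho>"
proof -
  interpret group_hom L G \<rho> using central_extension_hom assms by blast
  have "\<rho> (x \<otimes>\<^bsub>L\<^esub> y \<otimes>\<^bsub>L\<^esub> inv\<^bsub>L\<^esub> x \<otimes>\<^bsub>L\<^esub> inv\<^bsub>L\<^esub> y) = \<one>\<^bsub>G\<^esub>"
    using iffD2[OF H.commutator_one_iff[of "\<rho> x" "\<rho> y"] assms(5)] assms(3,4) by simp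
  then show ?thesis using assms by (simp add: kernel_def)
qed

text \<open>The images commute, so the commutator of \<open>x\<close> and \<open>y\<close> lies in
  the kernel and is central; \<open>central_commutator_coprime\<close> then makes it
  trivial.\<close>

lemma coprime_commute_central_extension:
  assumes "group G" "coprime_commute G" "central_extension G L \<rho>"
  shows "coprime_commute L"
proof -
  interpret group_hom L G \<rho> using central_extension_hom assms by blast
  have "x \<otimes>\<^bsub>L\<^esub> y = y \<otimes>\<^bsub>L\<^esub> x"
    if L: "x \<in> carrier L" "y \<in> carrier L" and mn: "coprime m (n::nat)"
      and p: "x [^]\<^bsub>L\<^esub> m = \<one>\<^bsub>L\<^esub>" "y [^]\<^bsub>L\<^esub> n = \<one>\<^bsub>L\<^esub>" for x y m n
  proof -
    have "\<rho> x [^]\<^bsub>G\<^esub> m = \<one>\<^bsub>G\<^esub>" "\<rho> y [^]\<^bsub>G\<^esub> n = \<one>\<^bsub>G\<^esub>"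
      using L p by (metis hom_nat_pow hom_one)+
    then have "\<rho> x \<otimes>\<^bsub>G\<^esub> \<rho> y = \<rho> y \<otimes>\<^bsub>G\<^esub> \<rho> x"
      using coprime_commuteD[OF assms(2) _ _ mn] L hom_closed by metis
    from central_extension_commutator_kernel[OF assms(1,3) L this]
    have c: "x \<otimes>\<^bsub>L\<^esub> y \<otimes>\<^bsub>L\<^esub> inv\<^bsub>L\<^esub> x \<otimes>\<^bsub>L\<^esub> inv\<^bsub>L\<^esub> y \<in> grp_center L" (is "?c \<in> _")
      using assms(3) by (auto simp: central_extension_def)
    have "x \<otimes>\<^bsub>L\<^esub> y = ?c \<otimes>\<^bsub>L\<^esub> (y \<otimes>\<^bsub>L\<^esub> x)"
      using L by (rule G.mult_eq_commutator_mult)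
    then show ?thesis
      using G.central_commutator_coprime[OF L _ _ _ _ p mn, of ?c] c L
      by (auto simp: grp_center_def)
  qed
  then show ?thesis by (rule coprime_commuteI)
qed

section \<open>Descent along the lower central series\<close>

lemma (in group) lower_central_normal: "lower_central G n \<lhd> G"
proof (induction n)
  case 0 show ?case by (simp add: normal_self)
next
  case (Suc n)
  interpret N: normal "lower_central G n" G by (rule Suc)
  show ?case unfolding lower_central.simps
  proof (rule normal_generateI)
    fix h g assume h: "h \<in> (\<Union>x\<in>lower_central G n. \<Union>y\<in>carrier G. {x \<otimes> y \<otimes> inv x \<otimes> inv y})"
      and g: "g \<in> carrier G"
    then obtain x y where xy: "x \<in> lower_central G n" "y \<in> carrier G"
      "h = x \<otimes> y \<otimes> inv x \<otimes> inv y" by blast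
    have "h \<in> carrier G" "x \<in> carrier G" using xy N.subset by auto
    have c: "g \<otimes> a \<otimes> inv g \<otimes> (g \<otimes> b \<otimes> inv g) = g \<otimes> (a \<otimes> b) \<otimes> inv g"
      if "a \<in> carrier G" "b \<in> carrier G" for a b
      using that g by (simp add: m_assoc inv_solve_left inv_solve_left')
    have i: "inv (g \<otimes> a \<otimes> inv g) = g \<otimes> inv a \<otimes> inv g" if "a \<in> carrier G" for a
      using that g by (simp add: m_assoc inv_mult_group)
    have "g \<otimes> h \<otimes> inv g = (g \<otimes> x \<otimes> inv g) \<otimes> (g \<otimes> y \<otimes> inv g) \<otimes> inv (g \<otimes> x \<otimes> inv g) \<otimes> inv (g \<otimes> y \<otimes> inv g)"
      using xy g \<open>x \<in> carrier G\<close> by (simp add: c i)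
    moreover have "g \<otimes> x \<otimes> inv g \<in> lower_central G n" using N.inv_op_closed2 xy g by simp
    ultimately show "g \<otimes> h \<otimes> inv g \<in> (\<Union>x\<in>lower_central G n. \<Union>y\<in>carrier G. {x \<otimes> y \<otimes> inv x \<otimes> inv y})"
      using xy g by (intro UN_I[of "g \<otimes> x \<otimes> inv g"] UN_I[of "g \<otimes> y \<otimes> inv g"]) auto
  next
    show "(\<Union>x\<in>lower_central G n. \<Union>y\<in>carrier G. {x \<otimes> y \<otimes> inv x \<otimes> inv y}) \<subseteq> carrier G"
      using N.subset by (intro UN_least) auto
  qed
qed

text \<open>Modulo \<open>H\<close> the element \<open>c\<close> is central, because its commutators
  lie in \<open>H\<close>; as the commutator of two elements with coprime exponents it is then
  trivial there. \<open>H\<close> stands for the next term of the lower central series.\<close>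

lemma (in normal) coprime_commutator_mem:
  assumes G: "x \<in> carrier G" "y \<in> carrier G" and mn: "coprime m (n::nat)"
    and p: "x [^] m = \<one>" "y [^] n = \<one>"
    and c: "c = x \<otimes> y \<otimes> inv x \<otimes> inv y"
    and cz: "\<And>z. z \<in> carrier G \<Longrightarrow> c \<otimes> z \<otimes> inv c \<otimes> inv z \<in> H"
  shows "c \<in> H"
proof -
  interpret Q: group "G Mod H" by (rule factorgroup_is_group)
  define q where "q = (\<lambda>z. H #> z)"
  interpret q: group_hom G "G Mod H" q
    unfolding q_def by unfold_locales (rule r_coset_hom_Mod)
  have cG: "c \<in> carrier G" using c G by simp
  have q1: "q z = \<one>\<^bsub>G Mod H\<^esub> \<longleftrightarrow> z \<in> H" if "z \<in> carrier G" for z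
    using that unfolding q_def
    by (metis FactGroup_def subgroup_axioms coset_join1 coset_join2 monoid.select_convs(2) subgroup.subset)
  have cc: "q c \<otimes>\<^bsub>G Mod H\<^esub> q z = q z \<otimes>\<^bsub>G Mod H\<^esub> q c" if z: "z \<in> carrier G" for z
  proof -
    have "q (c \<otimes> z \<otimes> inv c \<otimes> inv z) = \<one>\<^bsub>G Mod H\<^esub>" using q1 cz[OF z] z cG by (simp del: q.hom_mult)
    then show ?thesis using Q.commutator_one_iff[of "q c" "q z"] z cG by simp
  qed
  have "x \<otimes> y = c \<otimes> (y \<otimes> x)" unfolding c using G by (rule mult_eq_commutator_mult)
  then have e: "q x \<otimes>\<^bsub>G Mod H\<^esub> q y = q c \<otimes>\<^bsub>G Mod H\<^esub> (q y \<otimes>\<^bsub>G Mod H\<^esub> q x)"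
    using G cG by (metis q.hom_mult m_closed)
  have pw: "q x [^]\<^bsub>G Mod H\<^esub> m = \<one>\<^bsub>G Mod H\<^esub>" "q y [^]\<^bsub>G Mod H\<^esub> n = \<one>\<^bsub>G Mod H\<^esub>"
    using p G by (metis q.hom_nat_pow q.hom_one)+
  have "q x \<otimes>\<^bsub>G Mod H\<^esub> q y = q y \<otimes>\<^bsub>G Mod H\<^esub> q x"
    by (rule Q.central_commutator_coprime[OF _ _ _ e cc cc pw mn]) (use G cG in auto)
  then have "q c = \<one>\<^bsub>G Mod H\<^esub>"
    using iffD2[OF Q.commutator_one_iff[of "q x" "q y"]] G unfolding c by simp
  then show ?thesis using q1 cG by simp
qed

text \<open>The commutator \<open>c\<close> descends through the whole series: if it lies in one
  term, its commutators lie in the next, and \<open>coprime_commutator_mem\<close> puts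
  \<open>c\<close> itself there.\<close>

lemma nilpotent_coprime_commute:
  assumes "nilpotent_group G"
  shows "coprime_commute G"
proof -
  interpret group G using assms[unfolded nilpotent_group_def] by (rule conjunct1)
  obtain k where k: "lower_central G k = {\<one>\<^bsub>G\<^esub>}"
    using assms[unfolded nilpotent_group_def, THEN conjunct2] by (rule exE)
  have "x \<otimes>\<^bsub>G\<^esub> y = y \<otimes>\<^bsub>G\<^esub> x"
    if G: "x \<in> carrier G" "y \<in> carrier G" and mn: "coprime m (n::nat)"
      and p: "x [^]\<^bsub>G\<^esub> m = \<one>\<^bsub>G\<^esub>" "y [^]\<^bsub>G\<^esub> n = \<one>\<^bsub>G\<^esub>" for x y m n
  proof -
    define c where "c = x \<otimes>\<^bsub>G\<^esub> y \<otimes>\<^bsub>G\<^esub> inv\<^bsub>G\<^esub> x \<otimes>\<^bsub>G\<^esub> inv\<^bsub>G\<^esub> y"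
    have "c \<in> lower_central G i" for i
    proof (induction i)
      case (Suc i)
      have "c \<otimes>\<^bsub>G\<^esub> z \<otimes>\<^bsub>G\<^esub> inv\<^bsub>G\<^esub> c \<otimes>\<^bsub>G\<^esub> inv\<^bsub>G\<^esub> z \<in> lower_central G (Suc i)" if "z \<in> carrier G" for z
        unfolding lower_central.simps
        by (rule generate.incl, rule UN_I[OF Suc], rule UN_I[OF that]) simp
      then show ?case
        using normal.coprime_commutator_mem[OF lower_central_normal G mn p c_def] by blast
    qed (use G c_def in simp)
    then have "c = \<one>\<^bsub>G\<^esub>" using k by blast
    then show ?thesis using commutator_one_iff[OF G] c_def by simp
  qed
  then show ?thesis by (rule coprime_commuteI)
qed

section \<open>Separating characters\<close>

text \<open>Hides the cosets: later arguments see an abstract group, a surjection and its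
  kernel.\<close>

lemma (in normal) quotient_map:
  "\<exists>(T :: 'a set monoid) q. group_hom G T q \<and> q ` carrier G = carrier T \<and>
     (\<forall>z \<in> carrier G. q z = \<one>\<^bsub>T\<^esub> \<longleftrightarrow> z \<in> H)"
proof (intro exI conjI)
  show "group_hom G (G Mod H) (\<lambda>z. H #> z)"
    using r_coset_hom_Mod factorgroup_is_group by (simp add: group_hom_def group_hom_axioms_def)
  show "(\<lambda>z. H #> z) ` carrier G = carrier (G Mod H)" by (simp add: carrier_FactGroup)
  show "\<forall>z \<in> carrier G. H #> z = \<one>\<^bsub>G Mod H\<^esub> \<longleftrightarrow> z \<in> H"
    using coset_join1[OF _ _ subgroup_axioms] coset_join2[OF _ subgroup_axioms] by auto
qed

text \<open>Let <x> have maximal order among cyclic subgroups; it is nontrivial, so it contains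
  \<open>a\<close>. If <x> is not everything, an element \<open>y\<close> of minimal order outside
  it satisfies y^q = x^j for a prime q. If q divides j, a power of \<open>x\<close> corrects
  \<open>y\<close> to an element of order q outside <x>; its powers include \<open>a\<close>, which
  then generates the same subgroup, a contradiction. Otherwise \<open>x\<close> and \<open>y\<close>
  are powers of one element, against maximality.\<close>

lemma (in comm_group) monolithic_imp_cyclic:
  assumes fin: "finite (carrier G)" and a: "a \<in> carrier G" "a \<noteq> \<one>"
    and mono: "\<And>U. subgroup U G \<Longrightarrow> U \<noteq> {\<one>} \<Longrightarrow> a \<in> U"
  shows "\<exists>t \<in> carrier G. \<forall>y \<in> carrier G. \<exists>i::int. y = t [^] i"
proof -
  define S where "S x = range (\<lambda>i::int. x [^] i)" for x
  have S: "subgroup (S x) G" if "x \<in> carrier G" for x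
    unfolding S_def using that by (rule subgroup_of_powers)
  have powS: "x [^] (i::int) \<in> S x" for x i unfolding S_def by (rule rangeI)
  have selfS: "x \<in> S x" if "x \<in> carrier G" for x using powS[of x 1] that by simp
  have finS: "finite (S x)" if "x \<in> carrier G" for x
    using S[OF that] fin finite_subset subgroup.subset by blast
  obtain x where x: "x \<in> carrier G" and max: "\<And>y. y \<in> carrier G \<Longrightarrow> card (S y) \<le> card (S x)"
  proof -
    have "finite ((\<lambda>x. card (S x)) ` carrier G)" "(\<lambda>x. card (S x)) ` carrier G \<noteq> {}"
      using fin a by auto
    then obtain x where "x \<in> carrier G" "card (S x) = Max ((\<lambda>x. card (S x)) ` carrier G)"
      using Max_in by (metis (no_types, lifting) imageE)
    then show ?thesis using that Max_ge fin by (metis (no_types, lifting) finite_imageI imageI)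
  qed
  have aS: "a \<in> S x"
  proof -
    have "S x \<noteq> {\<one>}"
    proof
      assume "S x = {\<one>}"
      moreover have "{\<one>, a} \<subseteq> S a" using selfS[OF a(1)] subgroup.one_closed[OF S[OF a(1)]] by simp
      then have "card {\<one>, a} \<le> card (S a)" using finS[OF a(1)] card_mono by blast
      ultimately show False using max[OF a(1)] a(2) by simp
    qed
    then show ?thesis using mono S x by blast
  qed
  have "y \<in> S x" if yG: "y \<in> carrier G" for y
  proof (rule ccontr)
    assume "y \<notin> S x"
    then obtain y where y: "y \<in> carrier G" "y \<notin> S x"
      and min: "\<And>z. z \<in> carrier G \<Longrightarrow> z \<notin> S x \<Longrightarrow> ord y \<le> ord z"
      using yG arg_min_nat_lemma[of "\<lambda>y. y \<in> carrier G \<and> y \<notin> S x" y ord] by blast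
    have y0: "ord y > 0" using ord_ge_1[OF fin y(1)] by simp
    have "ord y \<noteq> 1" using ord_eq_1[OF y(1)] y(2) subgroup.one_closed[OF S[OF x]] by auto
    then obtain q where q: "Factorial_Ring.prime q" "q dvd ord y" using prime_factor_nat by blast
    have "ord (y [^] q) = ord y div q" using ord_pow[OF y(1) q(2)] q(1) by (auto simp: prime_gt_0_nat)
    also have "\<dots> < ord y" using y0 q(1) prime_gt_1_nat by (simp add: div_less_dividend)
    finally have "y [^] q \<in> S x" using min[of "y [^] q"] y(1) by fastforce
    then obtain j :: int where j: "y [^] int q = x [^] j" unfolding S_def int_pow_int by blast
    show False
    proof (cases "int q dvd j")
      case True
      then obtain l where l: "j = int q * l" by blast
      define z where "z = y \<otimes> x [^] (- l)"
      have z: "z \<in> carrier G" using x y z_def by simp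
      have "z [^] int q = y [^] int q \<otimes> (x [^] (- l)) [^] int q"
        unfolding z_def using x y int_pow_distrib by simp
      also have "\<dots> = x [^] (j + - l * int q)"
        unfolding j int_pow_pow[OF x] int_pow_mult[OF x] ..
      finally have zq: "z [^] q = \<one>" using l by (simp add: int_pow_int)
      have zS: "z \<notin> S x"
      proof
        assume "z \<in> S x"
        then have "z \<otimes> x [^] l \<in> S x" using powS subgroup.m_closed[OF S[OF x]] by blast
        moreover have "z \<otimes> x [^] l = y" unfolding z_def using x y(1) by (simp add: m_assoc flip: int_pow_mult)
        ultimately show False using y(2) by simp
      qed
      have "S z \<noteq> {\<one>}" using selfS[OF z] zS subgroup.one_closed[OF S[OF x]] by auto
      then have "a \<in> S z" using mono S z by blast
      then obtain i :: int where i: "a = z [^] i" unfolding S_def by blast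
      show False
      proof (cases "int q dvd i")
        case True
        then obtain k where "i = int q * k" by blast
        then have "a = (z [^] int q) [^] k" using i z int_pow_pow by simp
        then show False using zq a(2) by (simp add: int_pow_int)
      next
        case False
        then have "coprime (int q) i" using q(1) by (simp add: prime_imp_coprime)
        then obtain u v where uv: "u * int q + v * i = 1" using bezout_int[of "int q" i] by auto
        have "z = z [^] (int q * u + i * v)" using uv z by (simp add: mult.commute)
        also have "\<dots> = (z [^] int q) [^] u \<otimes> a [^] v" using z i int_pow_mult int_pow_pow by simp
        also have "\<dots> = a [^] v" using zq a by (simp add: int_pow_int)
        finally have "z \<in> S x" using subgroup_int_pow_closed[OF S[OF x] aS] by metis
        then show False using zS by simp
      qed
    next
      case False
      then have "coprime (int q) j" using q(1) by (simp add: prime_imp_coprime)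
      then obtain u v where uv: "u * int q + v * j = 1" using bezout_int[of "int q" j] by auto
      \<comment> \<open>By the Bezout relation and y^q = x^j this choice gives w^q = x and w^j =
        y.\<close>
      define w where "w = x [^] u \<otimes> y [^] v"
      have w: "w \<in> carrier G" using x y w_def by simp
      have "w [^] int q = x [^] (u * int q) \<otimes> y [^] (v * int q)"
        unfolding w_def using x y int_pow_distrib int_pow_pow by simp
      also have "y [^] (v * int q) = x [^] (v * j)"
        using y(1) x j int_pow_pow[of y "int q" v] int_pow_pow[of x j v] by (simp add: mult.commute)
      also have "x [^] (u * int q) \<otimes> x [^] (v * j) = x" using uv x by (simp flip: int_pow_mult)
      finally have wx: "w [^] int q = x" .
      have "w [^] j = x [^] (u * j) \<otimes> y [^] (v * j)"
        unfolding w_def using x y int_pow_distrib int_pow_pow by simp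
      also have "x [^] (u * j) = y [^] (u * int q)"
        using y(1) x j int_pow_pow[of y "int q" u] int_pow_pow[of x j u] by (simp add: mult.commute)
      also have "y [^] (u * int q) \<otimes> y [^] (v * j) = y" using uv y by (simp flip: int_pow_mult)
      finally have wy: "w [^] j = y" .
      have "S x \<subseteq> S w"
      proof
        fix c assume "c \<in> S x"
        then obtain i :: int where "c = x [^] i" unfolding S_def by blast
        then have "c = w [^] (int q * i)" using wx w int_pow_pow by metis
        then show "c \<in> S w" using powS by simp
      qed
      moreover have "y \<in> S w" using wy powS by metis
      ultimately have "S x \<subset> S w" using y(2) by blast
      then have "card (S x) < card (S w)" using finS[OF w] psubset_card_mono by blast
      then show False using max[OF w] by simp
    qed
  qed
  then show ?thesis using x unfolding S_def by blast
qed

text \<open>\<open>f\<close> is a discrete logarithm to the base \<open>t\<close>. Each exponent is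
  an arbitrary choice, so \<open>f\<close> is additive only modulo the order of
  \<open>t\<close>.\<close>

lemma (in group) cyclic_coordinate:
  assumes t: "t \<in> carrier G" and gen: "\<forall>y \<in> carrier G. \<exists>i::int. y = t [^] i"
  obtains f :: "'a \<Rightarrow> int" where "\<forall>x \<in> carrier G. x = t [^] f x"
    "\<forall>x \<in> carrier G. \<forall>y \<in> carrier G. int (ord t) dvd f x + f y - f (x \<otimes> y)"
proof
  define f where "f x = (SOME i::int. x = t [^] i)" for x
  show f: "\<forall>x \<in> carrier G. x = t [^] f x"
    unfolding f_def using gen someI_ex[of "\<lambda>i::int. _ = t [^] i"] by blast
  show "\<forall>x \<in> carrier G. \<forall>y \<in> carrier G. int (ord t) dvd f x + f y - f (x \<otimes> y)"
  proof (intro ballI)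
    fix x y assume xy: "x \<in> carrier G" "y \<in> carrier G"
    have "t [^] f (x \<otimes> y) = x \<otimes> y" using f xy by simp
    also have "\<dots> = t [^] f x \<otimes> t [^] f y" using f xy by simp
    also have "\<dots> = t [^] (f x + f y)" by (rule int_pow_mult[OF t, symmetric])
    finally show "int (ord t) dvd f x + f y - f (x \<otimes> y)" using int_pow_eq[OF t] by blast
  qed
qed

lemma (in group) commutator_in_derived:
  assumes x: "x \<in> carrier G" and y: "y \<in> carrier G"
  shows "x \<otimes> y \<otimes> inv x \<otimes> inv y \<in> derived G (carrier G)"
  unfolding derived_def by (rule generate.incl, rule UN_I[OF x], rule UN_I[OF y]) simp

lemma (in group) normal_of_derived_subset:
  assumes N: "subgroup N G" and d: "derived G (carrier G) \<subseteq> N"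
  shows "N \<lhd> G"
proof (rule normal_invI[OF N])
  fix x h assume x: "x \<in> carrier G" and h: "h \<in> N"
  have hG: "h \<in> carrier G" using h N subgroup.subset by blast
  have "x \<otimes> h \<otimes> inv x \<otimes> inv h \<in> derived G (carrier G)"
    using x hG by (rule commutator_in_derived)
  then have "x \<otimes> h \<otimes> inv x \<otimes> inv h \<otimes> h \<in> N" using subgroup.m_closed[OF N _ h] d by blast
  then show "x \<otimes> h \<otimes> inv x \<in> N" using x hG by (simp add: m_assoc)
qed

text \<open>Let N be maximal among the subgroups that contain the derived subgroup and avoid
  \<open>a\<close>. The quotient by N is abelian, and the image of \<open>a\<close> lies in each of
  its nontrivial subgroups, so it is cyclic by \<open>monolithic_imp_cyclic\<close>. The discrete
  logarithm, reduced modulo the order of a generator, is the character.\<close>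

lemma (in group) separating_character:
  assumes fin: "finite (carrier G)" and a: "a \<in> carrier G" "a \<notin> derived G (carrier G)"
  obtains n :: int and \<psi> where "n > 0" "\<forall>x. 0 \<le> \<psi> x \<and> \<psi> x < n"
    "\<forall>x \<in> carrier G. \<forall>y \<in> carrier G. \<psi> (x \<otimes> y) = (\<psi> x + \<psi> y) mod n" "\<psi> a \<noteq> 0"
proof -
  let ?D = "derived G (carrier G)"
  define F where "F = {N. subgroup N G \<and> ?D \<subseteq> N \<and> a \<notin> N}"
  have "F \<subseteq> Pow (carrier G)" unfolding F_def using subgroup.subset by blast
  then have finF: "finite F" using fin by (meson finite_Pow_iff finite_subset)
  have "?D \<in> F" unfolding F_def using a derived_is_subgroup by simp
  then obtain N where N: "N \<in> F" and max: "\<And>V. V \<in> F \<Longrightarrow> N \<subseteq> V \<Longrightarrow> N = V"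
    using finite_has_maximal[OF finF] by blast
  have Nsub: "subgroup N G" and DN: "?D \<subseteq> N" and aN: "a \<notin> N" using N by (auto simp: F_def)
  interpret N: normal N G by (rule normal_of_derived_subset[OF Nsub DN])
  obtain T :: "'a set monoid" and q where hom: "group_hom G T q" and surj: "q ` carrier G = carrier T"
    and ker': "\<forall>z \<in> carrier G. q z = \<one>\<^bsub>T\<^esub> \<longleftrightarrow> z \<in> N"
    using N.quotient_map by (elim exE conjE)
  note ker = ker'[rule_format]
  interpret q: group_hom G T q by (rule hom)
  have comm: "comm_group T"
  proof (rule q.H.group_comm_groupI)
    fix c d assume "c \<in> carrier T" "d \<in> carrier T"
    then obtain x y where xy: "x \<in> carrier G" "y \<in> carrier G" "c = q x" "d = q y"
      by (metis imageE surj)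
    have "x \<otimes> y \<otimes> inv x \<otimes> inv y \<in> ?D"
      using xy(1,2) by (rule commutator_in_derived)
    then have "q (x \<otimes> y \<otimes> inv x \<otimes> inv y) = \<one>\<^bsub>T\<^esub>"
      using subsetD[OF DN] ker[of "x \<otimes> y \<otimes> inv x \<otimes> inv y"] xy(1,2) by (simp del: q.hom_mult)
    then show "c \<otimes>\<^bsub>T\<^esub> d = d \<otimes>\<^bsub>T\<^esub> c" using q.H.commutator_one_iff[of c d] xy by simp
  qed
  interpret T: comm_group T by (rule comm)
  have finT: "finite (carrier T)" using surj fin by (metis finite_imageI)
  have qa: "q a \<in> carrier T" "q a \<noteq> \<one>\<^bsub>T\<^esub>" using a ker aN by auto
  \<comment> \<open>The preimage of a nontrivial \<open>U\<close> properly contains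
    \<open>N\<close>, so maximality of \<open>N\<close> forces \<open>a\<close> into it.\<close>
  have mono: "q a \<in> U" if U: "subgroup U T" "U \<noteq> {\<one>\<^bsub>T\<^esub>}" for U
  proof -
    define V where "V = {x \<in> carrier G. q x \<in> U}"
    have Vs: "subgroup V G"
    proof (rule subgroupI)
      have "\<one> \<in> V" unfolding V_def using subgroup.one_closed[OF U(1)] by simp
      then show "V \<noteq> {}" by blast
    qed (use subgroup.m_closed[OF U(1)] subgroup.m_inv_closed[OF U(1)] in \<open>auto simp: V_def\<close>)
    have NV: "N \<subseteq> V"
    proof
      fix x assume x: "x \<in> N"
      then have "x \<in> carrier G" by (rule N.mem_carrier)
      then show "x \<in> V" unfolding V_def using ker[of x] x subgroup.one_closed[OF U(1)] by simp
    qed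
    obtain c where c: "c \<in> U" "c \<noteq> \<one>\<^bsub>T\<^esub>" using U subgroup.one_closed[OF U(1)] by blast
    then have "c \<in> q ` carrier G" using surj subgroup.subset[OF U(1)] by auto
    then obtain x where x: "x \<in> carrier G" "q x = c" by blast
    then have "x \<in> V" "x \<notin> N" using c ker V_def by auto
    then have "V \<notin> F" using max[of V] NV by auto
    then have "a \<in> V" using Vs subset_trans[OF DN NV] unfolding F_def by simp
    then show ?thesis using V_def by blast
  qed
  have cyc: "\<exists>t \<in> carrier T. \<forall>y \<in> carrier T. \<exists>i::int. y = t [^]\<^bsub>T\<^esub> i"
    by (rule T.monolithic_imp_cyclic[OF finT qa]) (rule mono)
  obtain t where t: "t \<in> carrier T" and gen: "\<forall>y \<in> carrier T. \<exists>i::int. y = t [^]\<^bsub>T\<^esub> i"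
    using cyc by (elim bexE)
  obtain f :: "'a set \<Rightarrow> int" where f': "\<forall>x \<in> carrier T. x = t [^]\<^bsub>T\<^esub> f x"
    "\<forall>x \<in> carrier T. \<forall>y \<in> carrier T. int (q.H.ord t) dvd f x + f y - f (x \<otimes>\<^bsub>T\<^esub> y)"
    using q.H.cyclic_coordinate[OF t gen] by metis
  note f = f'[rule_format]
  let ?n = "int (q.H.ord t)"
  have n: "?n > 0" using q.H.ord_ge_1[OF finT t] by simp
  show ?thesis
  proof (rule that[of ?n "\<lambda>x. f (q x) mod ?n"])
    show "\<forall>x \<in> carrier G. \<forall>y \<in> carrier G. f (q (x \<otimes> y)) mod ?n = (f (q x) mod ?n + f (q y) mod ?n) mod ?n"
    proof (intro ballI)
      fix x y assume "x \<in> carrier G" "y \<in> carrier G"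
      then have "?n dvd f (q x) + f (q y) - f (q (x \<otimes> y))" using f(2)[of "q x" "q y"] by simp
      then show "f (q (x \<otimes> y)) mod ?n = (f (q x) mod ?n + f (q y) mod ?n) mod ?n"
        by (metis mod_add_eq mod_eq_dvd_iff)
    qed
    show "f (q a) mod ?n \<noteq> 0"
    proof
      assume "f (q a) mod ?n = 0"
      then have "t [^]\<^bsub>T\<^esub> f (q a) = \<one>\<^bsub>T\<^esub>" using q.H.int_pow_eq_id[OF t] by (simp add: dvd_eq_mod_eq_0)
      then show False using f(1)[OF qa(1)] qa(2) by simp
    qed
  qed (use n in simp_all)
qed

section \<open>Reduction to stem extensions\<close>

text \<open>\<psi> is a homomorphism to the integers modulo \<open>n\<close> with values normalised
  to 0..<n. A nonzero value at \<open>a\<close> certifies that \<open>a\<close> is outside the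
  derived subgroup. The bounds are imposed on the whole type, so that they apply without carrier
  conditions.\<close>

locale kernel_reduction = group_hom L G \<rho> for L :: "'b monoid" and G and \<rho> +
  fixes \<psi> :: "'b \<Rightarrow> int" and n :: int and a :: 'b
  assumes npos: "n > 0" and range: "\<And>x. 0 \<le> \<psi> x \<and> \<psi> x < n"
    and psi_mult: "\<And>x y. x \<in> carrier L \<Longrightarrow> y \<in> carrier L \<Longrightarrow> \<psi> (x \<otimes>\<^bsub>L\<^esub> y) = (\<psi> x + \<psi> y) mod n"
    and aL: "a \<in> carrier L" and rho_a: "\<rho> a = \<one>\<^bsub>G\<^esub>" and psi_a: "\<psi> a \<noteq> 0"
    and central: "\<And>x. x \<in> carrier L \<Longrightarrow> a \<otimes>\<^bsub>L\<^esub> x = x \<otimes>\<^bsub>L\<^esub> a"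
begin

text \<open>
  The quotient of $\{(x, i) \in L \times \mathbb{Z} \mid i \equiv \psi\,x \bmod n\}$ by the central
  subgroup generated by $(a, \psi\,a)$, with representatives $0 \le i < \psi\,a$; since
  $\psi\,a < n$, the integer $i$ is then $\psi\,x$. The element $a$ leaves the kernel, while
  commutators have second component 0 and survive.
\<close>

definition Lred :: "'b monoid" where
  "Lred = \<lparr>carrier = {x \<in> carrier L. \<psi> x < \<psi> a},
    monoid.mult = (\<lambda>x y. x \<otimes>\<^bsub>L\<^esub> y \<otimes>\<^bsub>L\<^esub> a [^]\<^bsub>L\<^esub> (- ((\<psi> x + \<psi> y) div \<psi> a))), one = \<one>\<^bsub>L\<^esub>\<rparr>"

lemma carrier_Lred: "x \<in> carrier Lred \<longleftrightarrow> x \<in> carrier L \<and> \<psi> x < \<psi> a" by (simp add: Lred_def)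

lemma mult_Lred: "x \<otimes>\<^bsub>Lred\<^esub> y = x \<otimes>\<^bsub>L\<^esub> y \<otimes>\<^bsub>L\<^esub> a [^]\<^bsub>L\<^esub> (- ((\<psi> x + \<psi> y) div \<psi> a))"
  by (simp add: Lred_def)

lemma one_Lred: "\<one>\<^bsub>Lred\<^esub> = \<one>\<^bsub>L\<^esub>" by (simp add: Lred_def)

lemma s_pos: "0 < \<psi> a" using psi_a range[of a] by simp

lemma psi_one: "\<psi> \<one>\<^bsub>L\<^esub> = 0"
proof -
  have "\<psi> \<one>\<^bsub>L\<^esub> = (\<psi> \<one>\<^bsub>L\<^esub> + \<psi> \<one>\<^bsub>L\<^esub>) mod n" using psi_mult[of "\<one>\<^bsub>L\<^esub>" "\<one>\<^bsub>L\<^esub>"] by simp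
  then have "n dvd \<psi> \<one>\<^bsub>L\<^esub> + \<psi> \<one>\<^bsub>L\<^esub> - \<psi> \<one>\<^bsub>L\<^esub>" by (metis dvd_minus_mod)
  then show ?thesis using range[of "\<one>\<^bsub>L\<^esub>"] npos by (metis add_diff_cancel_left' order_le_less zdvd_not_zless)
qed

lemma psi_inv:
  assumes "x \<in> carrier L" shows "\<psi> (inv\<^bsub>L\<^esub> x) = (- \<psi> x) mod n"
proof -
  have "(\<psi> x + \<psi> (inv\<^bsub>L\<^esub> x)) mod n = 0" using psi_mult[of x "inv\<^bsub>L\<^esub> x"] psi_one assms by simp
  then have "n dvd \<psi> (inv\<^bsub>L\<^esub> x) - (- \<psi> x)" by (simp add: mod_eq_0_iff_dvd add.commute)
  then have "\<psi> (inv\<^bsub>L\<^esub> x) mod n = (- \<psi> x) mod n" by (simp add: mod_eq_dvd_iff)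
  then show ?thesis using range[of "inv\<^bsub>L\<^esub> x"] by simp
qed

lemma psi_pow: "\<psi> (a [^]\<^bsub>L\<^esub> (k::nat)) = (int k * \<psi> a) mod n"
proof (induction k)
  case (Suc k)
  have "\<psi> (a [^]\<^bsub>L\<^esub> Suc k) = ((int k * \<psi> a) mod n + \<psi> a) mod n" using psi_mult aL Suc by simp
  also have "\<dots> = (int (Suc k) * \<psi> a) mod n" by (simp add: mod_add_left_eq mod_add_right_eq distrib_right add.commute)
  finally show ?case .
qed (simp add: psi_one)

lemma psi_int_pow: "\<psi> (a [^]\<^bsub>L\<^esub> (k::int)) = (k * \<psi> a) mod n"
proof (cases k rule: int_cases2)
  case (nonneg m) then show ?thesis using psi_pow by (simp add: int_pow_int)
next
  case (nonpos m)
  have "\<psi> (a [^]\<^bsub>L\<^esub> k) = (- ((int m * \<psi> a) mod n)) mod n"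
    using nonpos psi_inv[of "a [^]\<^bsub>L\<^esub> m"] psi_pow aL by (simp add: G.int_pow_neg_int)
  then show ?thesis using nonpos by (simp add: mod_minus_eq)
qed

lemma psi_mult_pow:
  assumes "x \<in> carrier L"
  shows "\<psi> (x \<otimes>\<^bsub>L\<^esub> a [^]\<^bsub>L\<^esub> (k::int)) = (\<psi> x + k * \<psi> a) mod n"
  using psi_mult[OF assms, of "a [^]\<^bsub>L\<^esub> k"] aL psi_int_pow by (simp add: mod_add_right_eq)

lemma pow_central:
  assumes "x \<in> carrier L"
  shows "a [^]\<^bsub>L\<^esub> (k::int) \<otimes>\<^bsub>L\<^esub> x = x \<otimes>\<^bsub>L\<^esub> a [^]\<^bsub>L\<^esub> k"
proof -
  have "a \<in> {y \<in> carrier L. y \<otimes>\<^bsub>L\<^esub> x = x \<otimes>\<^bsub>L\<^esub> y}" using central[OF assms] aL by simp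
  from G.subgroup_int_pow_closed[OF G.centralizer_subgroup[OF assms] this, of k] show ?thesis by simp
qed

lemma rho_pow: "\<rho> (a [^]\<^bsub>L\<^esub> (k::int)) = \<one>\<^bsub>G\<^esub>"
  using aL rho_a by (simp add: hom_int_pow)

text \<open>The exponent in \<open>Lred\<close> counts how often (a, \<psi> a) is removed from a
  product to bring its integer coordinate below \<psi> a. The coordinate is thereby reduced modulo
  \<psi> a, and since \<psi> a < n the outer reduction modulo \<open>n\<close> changes
  nothing.\<close>

lemma psi_mult_Lred:
  assumes "x \<in> carrier L" "y \<in> carrier L"
  shows "\<psi> (x \<otimes>\<^bsub>Lred\<^esub> y) = (\<psi> x + \<psi> y) mod \<psi> a"
proof -
  have "\<psi> (x \<otimes>\<^bsub>Lred\<^esub> y) = ((\<psi> x + \<psi> y) mod n + - ((\<psi> x + \<psi> y) div \<psi> a) * \<psi> a) mod n"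
    unfolding mult_Lred using assms psi_mult by (subst psi_mult_pow) simp_all
  also have "\<dots> = (\<psi> x + \<psi> y - (\<psi> x + \<psi> y) div \<psi> a * \<psi> a) mod n"
    by (simp add: mod_diff_left_eq)
  also have "\<dots> = (\<psi> x + \<psi> y) mod \<psi> a mod n" by (simp add: minus_div_mult_eq_mod)
  also have "\<dots> = (\<psi> x + \<psi> y) mod \<psi> a"
    using range[of a] s_pos pos_mod_bound[OF s_pos, of "\<psi> x + \<psi> y"]
    by (intro mod_pos_pos_trivial pos_mod_sign) linarith+
  finally show ?thesis .
qed

lemma Lred_closed:
  assumes "x \<in> carrier L" "y \<in> carrier L"
  shows "x \<otimes>\<^bsub>Lred\<^esub> y \<in> carrier Lred"
proof -
  have "x \<otimes>\<^bsub>Lred\<^esub> y \<in> carrier L" unfolding mult_Lred using assms aL by simp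
  then show ?thesis using psi_mult_Lred[OF assms] s_pos by (simp add: carrier_Lred)
qed

text \<open>The exponents of \<open>a\<close> are the carries of an addition with base \<psi> a.
  Both bracketings carry (\<psi> x + \<psi> y + \<psi> z) div \<psi> a in total, which is the
  cocycle identity of carrying.\<close>

lemma Lred_assoc:
  assumes x: "x \<in> carrier L" and y: "y \<in> carrier L" and z: "z \<in> carrier L"
  shows "x \<otimes>\<^bsub>Lred\<^esub> y \<otimes>\<^bsub>Lred\<^esub> z = x \<otimes>\<^bsub>Lred\<^esub> (y \<otimes>\<^bsub>Lred\<^esub> z)"
proof -
  have carry: "(A + B) div \<psi> a = A div \<psi> a + (A mod \<psi> a + B) div \<psi> a" for A B :: int
  proof -
    have "A + B = (A mod \<psi> a + B) + A div \<psi> a * \<psi> a" using mod_div_mult_eq[of A "\<psi> a"] by linarith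
    then show ?thesis using s_pos div_mult_self1[of "\<psi> a" "A mod \<psi> a + B" "A div \<psi> a"] by simp
  qed
  let ?p = "\<lambda>k. a [^]\<^bsub>L\<^esub> (- (k::int))"
  have p: "?p k \<in> carrier L" for k using aL by simp
  have pp: "?p k \<otimes>\<^bsub>L\<^esub> ?p l = ?p (k + l)" for k l
    using G.int_pow_mult[OF aL, of "- k" "- l"] by simp
  have "x \<otimes>\<^bsub>Lred\<^esub> y \<otimes>\<^bsub>Lred\<^esub> z = x \<otimes>\<^bsub>L\<^esub> y \<otimes>\<^bsub>L\<^esub> ?p ((\<psi> x + \<psi> y) div \<psi> a) \<otimes>\<^bsub>L\<^esub> z
      \<otimes>\<^bsub>L\<^esub> ?p (((\<psi> x + \<psi> y) mod \<psi> a + \<psi> z) div \<psi> a)"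
    unfolding mult_Lred[of "x \<otimes>\<^bsub>Lred\<^esub> y"] psi_mult_Lred[OF x y] by (simp add: mult_Lred)
  also have "\<dots> = x \<otimes>\<^bsub>L\<^esub> y \<otimes>\<^bsub>L\<^esub> z \<otimes>\<^bsub>L\<^esub>
      (?p ((\<psi> x + \<psi> y) div \<psi> a) \<otimes>\<^bsub>L\<^esub> ?p (((\<psi> x + \<psi> y) mod \<psi> a + \<psi> z) div \<psi> a))"
  proof -
    have "x \<otimes>\<^bsub>L\<^esub> y \<otimes>\<^bsub>L\<^esub> ?p k \<otimes>\<^bsub>L\<^esub> z \<otimes>\<^bsub>L\<^esub> ?p l = x \<otimes>\<^bsub>L\<^esub> y \<otimes>\<^bsub>L\<^esub> z \<otimes>\<^bsub>L\<^esub> (?p k \<otimes>\<^bsub>L\<^esub> ?p l)" for k l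
    proof -
      have "x \<otimes>\<^bsub>L\<^esub> y \<otimes>\<^bsub>L\<^esub> ?p k \<otimes>\<^bsub>L\<^esub> z \<otimes>\<^bsub>L\<^esub> ?p l = x \<otimes>\<^bsub>L\<^esub> y \<otimes>\<^bsub>L\<^esub> (?p k \<otimes>\<^bsub>L\<^esub> z) \<otimes>\<^bsub>L\<^esub> ?p l"
        using x y z p by (simp add: G.m_assoc)
      also have "\<dots> = x \<otimes>\<^bsub>L\<^esub> y \<otimes>\<^bsub>L\<^esub> z \<otimes>\<^bsub>L\<^esub> (?p k \<otimes>\<^bsub>L\<^esub> ?p l)"
        unfolding pow_central[OF z] using x y z p by (simp add: G.m_assoc)
      finally show ?thesis .
    qed
    then show ?thesis .
  qed
  also have "\<dots> = x \<otimes>\<^bsub>L\<^esub> y \<otimes>\<^bsub>L\<^esub> z \<otimes>\<^bsub>L\<^esub> ?p ((\<psi> x + \<psi> y + \<psi> z) div \<psi> a)"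
    unfolding pp using carry[of "\<psi> x + \<psi> y" "\<psi> z"] by simp
  also have "(\<psi> x + \<psi> y + \<psi> z) div \<psi> a = (\<psi> y + \<psi> z) div \<psi> a + (\<psi> x + (\<psi> y + \<psi> z) mod \<psi> a) div \<psi> a"
    using carry[of "\<psi> y + \<psi> z" "\<psi> x"] by (simp add: add_ac)
  also have "x \<otimes>\<^bsub>L\<^esub> y \<otimes>\<^bsub>L\<^esub> z \<otimes>\<^bsub>L\<^esub> ?p \<dots> = x \<otimes>\<^bsub>L\<^esub> (y \<otimes>\<^bsub>L\<^esub> z \<otimes>\<^bsub>L\<^esub> ?p ((\<psi> y + \<psi> z) div \<psi> a))
      \<otimes>\<^bsub>L\<^esub> ?p ((\<psi> x + (\<psi> y + \<psi> z) mod \<psi> a) div \<psi> a)"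
    unfolding pp[symmetric] using x y z p by (simp add: G.m_assoc)
  also have "\<dots> = x \<otimes>\<^bsub>Lred\<^esub> (y \<otimes>\<^bsub>Lred\<^esub> z)"
    unfolding mult_Lred[of x "y \<otimes>\<^bsub>Lred\<^esub> z"] psi_mult_Lred[OF y z] by (simp add: mult_Lred)
  finally show ?thesis .
qed

lemma group_Lred: "group Lred"
proof (rule groupI)
  fix x y assume "x \<in> carrier Lred" "y \<in> carrier Lred"
  then show "x \<otimes>\<^bsub>Lred\<^esub> y \<in> carrier Lred" using Lred_closed carrier_Lred by blast
next
  show "\<one>\<^bsub>Lred\<^esub> \<in> carrier Lred" using psi_one s_pos by (simp add: carrier_Lred one_Lred)
next
  fix x y z assume "x \<in> carrier Lred" "y \<in> carrier Lred" "z \<in> carrier Lred"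
  then show "x \<otimes>\<^bsub>Lred\<^esub> y \<otimes>\<^bsub>Lred\<^esub> z = x \<otimes>\<^bsub>Lred\<^esub> (y \<otimes>\<^bsub>Lred\<^esub> z)" using Lred_assoc carrier_Lred by blast
next
  fix x assume "x \<in> carrier Lred"
  then show "\<one>\<^bsub>Lred\<^esub> \<otimes>\<^bsub>Lred\<^esub> x = x" using range[of x] by (simp add: carrier_Lred one_Lred mult_Lred psi_one)
next
  fix x assume x: "x \<in> carrier Lred"
  then have xL: "x \<in> carrier L" and xs: "\<psi> x < \<psi> a" by (simp_all add: carrier_Lred)
  show "\<exists>y \<in> carrier Lred. y \<otimes>\<^bsub>Lred\<^esub> x = \<one>\<^bsub>Lred\<^esub>"
  proof (cases "\<psi> x = 0")
    case True
    then show ?thesis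
      using xL psi_inv[OF xL] s_pos by (intro bexI[of _ "inv\<^bsub>L\<^esub> x"]) (simp_all add: carrier_Lred one_Lred mult_Lred)
  next
    case False
    \<comment> \<open>The inverse of \<open>x\<close> has the negative integer coordinate - \<psi>
      x; one factor (a, \<psi> a) raises it to \<psi> a - \<psi> x. In the product with
      \<open>x\<close> the carry is 1 and removes this \<open>a\<close> again.\<close>
    define y where "y = inv\<^bsub>L\<^esub> x \<otimes>\<^bsub>L\<^esub> a"
    have yL: "y \<in> carrier L" using xL aL y_def by simp
    have "\<psi> y = (- \<psi> x mod n + \<psi> a) mod n" unfolding y_def using psi_mult psi_inv xL aL by simp
    also have "\<dots> = (\<psi> a - \<psi> x) mod n" by (simp add: mod_add_left_eq)
    also have "\<dots> = \<psi> a - \<psi> x" using xs range[of a] range[of x] by (intro mod_pos_pos_trivial) auto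
    finally have y: "\<psi> y = \<psi> a - \<psi> x" .
    have "y \<otimes>\<^bsub>Lred\<^esub> x = inv\<^bsub>L\<^esub> x \<otimes>\<^bsub>L\<^esub> a \<otimes>\<^bsub>L\<^esub> x \<otimes>\<^bsub>L\<^esub> inv\<^bsub>L\<^esub> a"
      unfolding mult_Lred y using s_pos aL y_def by (simp add: G.int_pow_neg)
    also have "\<dots> = inv\<^bsub>L\<^esub> x \<otimes>\<^bsub>L\<^esub> (a \<otimes>\<^bsub>L\<^esub> x) \<otimes>\<^bsub>L\<^esub> inv\<^bsub>L\<^esub> a"
      using xL aL by (simp add: G.m_assoc)
    also have "\<dots> = inv\<^bsub>L\<^esub> x \<otimes>\<^bsub>L\<^esub> (x \<otimes>\<^bsub>L\<^esub> a) \<otimes>\<^bsub>L\<^esub> inv\<^bsub>L\<^esub> a" using central[OF xL] by simp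
    also have "\<dots> = \<one>\<^bsub>L\<^esub>" using xL aL by (simp add: G.m_assoc)
    finally have "y \<otimes>\<^bsub>Lred\<^esub> x = \<one>\<^bsub>Lred\<^esub>" by (simp add: one_Lred)
    moreover have "y \<in> carrier Lred" using yL y False range[of x] by (simp add: carrier_Lred)
    ultimately show ?thesis by blast
  qed
qed

lemma rho_mult_Lred:
  assumes "x \<in> carrier L" "y \<in> carrier L"
  shows "\<rho> (x \<otimes>\<^bsub>Lred\<^esub> y) = \<rho> x \<otimes>\<^bsub>G\<^esub> \<rho> y"
  unfolding mult_Lred using assms aL rho_pow by simp

text \<open>The class of (x, \<psi> x), normalised by removing (a, \<psi> a) as often as it fits. It
  differs from \<open>x\<close> by a central element of the kernel of \<rho>.\<close>

definition representative where "representative x = x \<otimes>\<^bsub>L\<^esub> a [^]\<^bsub>L\<^esub> (- (\<psi> x div \<psi> a))"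

lemma representative_Lred: "x \<in> carrier L \<Longrightarrow> representative x \<in> carrier Lred"
proof -
  assume x: "x \<in> carrier L"
  have "representative x = x \<otimes>\<^bsub>Lred\<^esub> \<one>\<^bsub>L\<^esub>" using x by (simp add: representative_def mult_Lred psi_one)
  then show ?thesis using Lred_closed[OF x G.one_closed] by simp
qed

lemma image_Lred: "\<rho> ` carrier Lred = \<rho> ` carrier L"
proof
  show "\<rho> ` carrier L \<subseteq> \<rho> ` carrier Lred"
  proof
    fix g assume "g \<in> \<rho> ` carrier L"
    then obtain x where x: "x \<in> carrier L" "g = \<rho> x" by blast
    then have "g = \<rho> (representative x)" unfolding representative_def using aL rho_pow by simp
    then show "g \<in> \<rho> ` carrier Lred" using representative_Lred[OF x(1)] by blast
  qed
qed (use carrier_Lred in blast)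

text \<open>A character vanishes on commutators, so the commutator d formed in \<open>L\<close>
  enters products of \<open>Lred\<close> without a carry. The products x y and y x have equal
  carries, hence d solves in \<open>Lred\<close> the equation d (y x) = x y that determines the
  commutator there.\<close>

lemma commutator_Lred:
  assumes x: "x \<in> carrier Lred" and y: "y \<in> carrier Lred"
  shows "x \<otimes>\<^bsub>Lred\<^esub> y \<otimes>\<^bsub>Lred\<^esub> inv\<^bsub>Lred\<^esub> x \<otimes>\<^bsub>Lred\<^esub> inv\<^bsub>Lred\<^esub> y = x \<otimes>\<^bsub>L\<^esub> y \<otimes>\<^bsub>L\<^esub> inv\<^bsub>L\<^esub> x \<otimes>\<^bsub>L\<^esub> inv\<^bsub>L\<^esub> y"
    (is "?c = ?d")
    and "\<psi> (x \<otimes>\<^bsub>L\<^esub> y \<otimes>\<^bsub>L\<^esub> inv\<^bsub>L\<^esub> x \<otimes>\<^bsub>L\<^esub> inv\<^bsub>L\<^esub> y) = 0"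
proof -
  interpret Lred: group Lred by (rule group_Lred)
  have xL: "x \<in> carrier L" and yL: "y \<in> carrier L" using x y by (simp_all add: carrier_Lred)
  have "\<psi> ?d = (((\<psi> x + \<psi> y) mod n + - \<psi> x mod n) mod n + - \<psi> y mod n) mod n"
    using xL yL psi_mult psi_inv by simp
  also have "\<dots> = (\<psi> x + \<psi> y + - \<psi> x + - \<psi> y) mod n" by (metis mod_add_eq)
  finally show d0: "\<psi> ?d = 0" by simp
  have dL: "?d \<in> carrier L" using xL yL by simp
  have yx: "y \<otimes>\<^bsub>Lred\<^esub> x \<in> carrier Lred" using x y by simp
  have "?c \<otimes>\<^bsub>Lred\<^esub> (y \<otimes>\<^bsub>Lred\<^esub> x) = x \<otimes>\<^bsub>Lred\<^esub> y"
    using Lred.mult_eq_commutator_mult[OF x y] by simp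
  also have "\<dots> = ?d \<otimes>\<^bsub>L\<^esub> (y \<otimes>\<^bsub>L\<^esub> x) \<otimes>\<^bsub>L\<^esub> a [^]\<^bsub>L\<^esub> (- ((\<psi> x + \<psi> y) div \<psi> a))"
    unfolding mult_Lred using G.mult_eq_commutator_mult[OF xL yL] by simp
  also have "\<dots> = ?d \<otimes>\<^bsub>Lred\<^esub> (y \<otimes>\<^bsub>Lred\<^esub> x)"
  proof -
    have "(\<psi> ?d + \<psi> (y \<otimes>\<^bsub>Lred\<^esub> x)) div \<psi> a = 0"
      unfolding d0 psi_mult_Lred[OF yL xL] using s_pos by simp
    then have "?d \<otimes>\<^bsub>Lred\<^esub> (y \<otimes>\<^bsub>Lred\<^esub> x) = ?d \<otimes>\<^bsub>L\<^esub> (y \<otimes>\<^bsub>Lred\<^esub> x) \<otimes>\<^bsub>L\<^esub> a [^]\<^bsub>L\<^esub> (- 0 :: int)"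
      unfolding mult_Lred[of ?d] by presburger
    also have "\<dots> = ?d \<otimes>\<^bsub>L\<^esub> (y \<otimes>\<^bsub>Lred\<^esub> x)" using dL yx carrier_Lred by simp
    also have "\<dots> = ?d \<otimes>\<^bsub>L\<^esub> (y \<otimes>\<^bsub>L\<^esub> x \<otimes>\<^bsub>L\<^esub> a [^]\<^bsub>L\<^esub> (- ((\<psi> x + \<psi> y) div \<psi> a)))"
      by (simp add: mult_Lred add.commute)
    also have "\<dots> = ?d \<otimes>\<^bsub>L\<^esub> (y \<otimes>\<^bsub>L\<^esub> x) \<otimes>\<^bsub>L\<^esub> a [^]\<^bsub>L\<^esub> (- ((\<psi> x + \<psi> y) div \<psi> a))"
      by (rule G.m_assoc[symmetric]) (use dL xL yL aL in auto)
    finally show ?thesis by (rule sym)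
  qed
  finally have "?c \<otimes>\<^bsub>Lred\<^esub> (y \<otimes>\<^bsub>Lred\<^esub> x) = ?d \<otimes>\<^bsub>Lred\<^esub> (y \<otimes>\<^bsub>Lred\<^esub> x)" .
  moreover have "?d \<in> carrier Lred" using dL d0 s_pos by (simp add: carrier_Lred)
  ultimately show "?c = ?d" using Lred.right_cancel[OF yx] x y by simp
qed

text \<open>An element and its representative differ by a central power of \<open>a\<close>, and
  central factors cancel in commutators.\<close>

lemma representative_commutator:
  assumes x: "x \<in> carrier L" and y: "y \<in> carrier L"
  shows "representative x \<otimes>\<^bsub>L\<^esub> representative y \<otimes>\<^bsub>L\<^esub> inv\<^bsub>L\<^esub> representative x \<otimes>\<^bsub>L\<^esub> inv\<^bsub>L\<^esub> representative y
    = x \<otimes>\<^bsub>L\<^esub> y \<otimes>\<^bsub>L\<^esub> inv\<^bsub>L\<^esub> x \<otimes>\<^bsub>L\<^esub> inv\<^bsub>L\<^esub> y" (is "?c = ?d")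
proof -
  define u where "u = a [^]\<^bsub>L\<^esub> (- (\<psi> x div \<psi> a))"
  define v where "v = a [^]\<^bsub>L\<^esub> (- (\<psi> y div \<psi> a))"
  have uv: "u \<in> carrier L" "v \<in> carrier L" using aL by (simp_all add: u_def v_def)
  have cu: "u \<otimes>\<^bsub>L\<^esub> z = z \<otimes>\<^bsub>L\<^esub> u" and cv: "v \<otimes>\<^bsub>L\<^esub> z = z \<otimes>\<^bsub>L\<^esub> v" if "z \<in> carrier L" for z
    using pow_central that by (simp_all add: u_def v_def)
  have n: "representative x = x \<otimes>\<^bsub>L\<^esub> u" "representative y = y \<otimes>\<^bsub>L\<^esub> v" by (simp_all add: representative_def u_def v_def)
  have nL: "representative x \<in> carrier L" "representative y \<in> carrier L" using n x y uv by simp_all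
  have dL: "?d \<in> carrier L" using x y by simp
  have "representative x \<otimes>\<^bsub>L\<^esub> representative y = x \<otimes>\<^bsub>L\<^esub> (u \<otimes>\<^bsub>L\<^esub> y) \<otimes>\<^bsub>L\<^esub> v" using n x y uv by (simp add: G.m_assoc)
  also have "\<dots> = x \<otimes>\<^bsub>L\<^esub> y \<otimes>\<^bsub>L\<^esub> (u \<otimes>\<^bsub>L\<^esub> v)" unfolding cu[OF y] using x y uv by (simp add: G.m_assoc)
  also have "\<dots> = ?d \<otimes>\<^bsub>L\<^esub> (y \<otimes>\<^bsub>L\<^esub> x) \<otimes>\<^bsub>L\<^esub> (u \<otimes>\<^bsub>L\<^esub> v)" using G.mult_eq_commutator_mult[OF x y] by simp
  also have "\<dots> = ?d \<otimes>\<^bsub>L\<^esub> (y \<otimes>\<^bsub>L\<^esub> x \<otimes>\<^bsub>L\<^esub> (v \<otimes>\<^bsub>L\<^esub> u))" unfolding cu[OF uv(2)] using x y uv dL by (simp add: G.m_assoc)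
  also have "y \<otimes>\<^bsub>L\<^esub> x \<otimes>\<^bsub>L\<^esub> (v \<otimes>\<^bsub>L\<^esub> u) = y \<otimes>\<^bsub>L\<^esub> (x \<otimes>\<^bsub>L\<^esub> v) \<otimes>\<^bsub>L\<^esub> u" using x y uv by (simp add: G.m_assoc)
  also have "\<dots> = representative y \<otimes>\<^bsub>L\<^esub> representative x" unfolding cv[OF x, symmetric] n using x y uv by (simp add: G.m_assoc)
  finally have "representative x \<otimes>\<^bsub>L\<^esub> representative y = ?d \<otimes>\<^bsub>L\<^esub> (representative y \<otimes>\<^bsub>L\<^esub> representative x)" .
  moreover have "representative x \<otimes>\<^bsub>L\<^esub> representative y = ?c \<otimes>\<^bsub>L\<^esub> (representative y \<otimes>\<^bsub>L\<^esub> representative x)"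
    using G.mult_eq_commutator_mult[OF nL] .
  ultimately show ?thesis
    using G.right_cancel[of "representative y \<otimes>\<^bsub>L\<^esub> representative x" ?c ?d] nL dL by simp
qed

text \<open>On elements with \<psi> = 0 the products of \<open>L\<close> and \<open>Lred\<close>
  coincide, so the part \<open>W\<close> of the derived subgroup of \<open>Lred\<close> with \<psi>
  = 0 is also a subgroup of \<open>L\<close>. It contains every commutator of \<open>L\<close>,
  because such a commutator can be formed from representatives.\<close>

lemma derived_Lred: "derived L (carrier L) \<subseteq> derived Lred (carrier Lred)"
proof -
  interpret Lred: group Lred by (rule group_Lred)
  let ?D = "derived Lred (carrier Lred)"
  define W where "W = {z \<in> ?D. \<psi> z = 0}"
  have Dsub: "subgroup ?D Lred" using Lred.derived_is_subgroup by simp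
  have WL: "z \<in> carrier L" "z \<in> carrier Lred" "z \<in> ?D" "\<psi> z = 0" if "z \<in> W" for z
    using that subgroup.subset[OF Dsub] carrier_Lred by (auto simp: W_def)
  have mult: "x \<otimes>\<^bsub>Lred\<^esub> y = x \<otimes>\<^bsub>L\<^esub> y" if "\<psi> x = 0" "\<psi> y = 0" "x \<in> carrier L" "y \<in> carrier L" for x y
    unfolding mult_Lred using that by simp
  have "subgroup W L"
  proof (rule G.subgroupI)
    show "W \<subseteq> carrier L" using WL by blast
    have "\<one>\<^bsub>L\<^esub> \<in> W" unfolding W_def using subgroup.one_closed[OF Dsub] psi_one by (simp add: one_Lred)
    then show "W \<noteq> {}" by blast
  next
    fix x assume x: "x \<in> W"
    note xW = WL[OF x]
    have "\<psi> (inv\<^bsub>L\<^esub> x) = 0" using psi_inv xW by simp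
    then have "inv\<^bsub>L\<^esub> x \<otimes>\<^bsub>Lred\<^esub> x = \<one>\<^bsub>Lred\<^esub>" "inv\<^bsub>L\<^esub> x \<in> carrier Lred"
      using mult xW s_pos by (simp_all add: one_Lred carrier_Lred)
    then have "inv\<^bsub>Lred\<^esub> x = inv\<^bsub>L\<^esub> x" using Lred.inv_equality xW by blast
    then show "inv\<^bsub>L\<^esub> x \<in> W" unfolding W_def
      using subgroup.m_inv_closed[OF Dsub xW(3)] \<open>\<psi> (inv\<^bsub>L\<^esub> x) = 0\<close> by simp
  next
    fix x y assume x: "x \<in> W" and y: "y \<in> W"
    have "x \<otimes>\<^bsub>L\<^esub> y \<in> ?D"
      using subgroup.m_closed[OF Dsub WL(3)[OF x] WL(3)[OF y]] mult WL[OF x] WL[OF y] by simp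
    then show "x \<otimes>\<^bsub>L\<^esub> y \<in> W" unfolding W_def using psi_mult WL[OF x] WL[OF y] by simp
  qed
  moreover have "derived_set L (carrier L) \<subseteq> W"
  proof (intro UN_least subsetI)
    fix x y z assume x: "x \<in> carrier L" and y: "y \<in> carrier L"
      and "z \<in> {x \<otimes>\<^bsub>L\<^esub> y \<otimes>\<^bsub>L\<^esub> inv\<^bsub>L\<^esub> x \<otimes>\<^bsub>L\<^esub> inv\<^bsub>L\<^esub> y}"
    then have z: "z = representative x \<otimes>\<^bsub>L\<^esub> representative y \<otimes>\<^bsub>L\<^esub> inv\<^bsub>L\<^esub> representative x \<otimes>\<^bsub>L\<^esub> inv\<^bsub>L\<^esub> representative y"
      using representative_commutator by simp
    note c = commutator_Lred[OF representative_Lred[OF x] representative_Lred[OF y]]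
    show "z \<in> W" unfolding W_def z
      using Lred.commutator_in_derived[OF representative_Lred[OF x] representative_Lred[OF y]] c by simp
  qed
  ultimately have "derived L (carrier L) \<subseteq> W"
    unfolding derived_def by (rule G.generate_subgroup_incl[rotated])
  then show ?thesis unfolding W_def by blast
qed

lemma kernel_Lred: "kernel L G \<rho> \<inter> derived L (carrier L) \<subseteq> kernel Lred G \<rho> \<inter> derived Lred (carrier Lred)"
proof -
  interpret Lred: group Lred by (rule group_Lred)
  have "derived Lred (carrier Lred) \<subseteq> carrier Lred" by (rule Lred.derived_in_carrier) simp
  then show ?thesis using derived_Lred unfolding kernel_def by blast
qed

lemma central_extension_Lred:
  assumes "central_extension G L \<rho>"
  shows "central_extension G Lred \<rho>"
proof -
  interpret Lred: group Lred by (rule group_Lred)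
  have "\<rho> \<in> hom Lred G" using rho_mult_Lred by (auto simp: hom_def carrier_Lred)
  moreover have "kernel Lred G \<rho> \<subseteq> grp_center Lred"
  proof
    fix k assume k: "k \<in> kernel Lred G \<rho>"
    then have "k \<in> kernel L G \<rho>" by (simp add: kernel_def carrier_Lred)
    then have "k \<otimes>\<^bsub>L\<^esub> x = x \<otimes>\<^bsub>L\<^esub> k" if "x \<in> carrier L" for x
      using assms that unfolding central_extension_def grp_center_def by blast
    then show "k \<in> grp_center Lred"
      using k unfolding grp_center_def by (simp add: kernel_def carrier_Lred mult_Lred add.commute)
  qed
  ultimately show ?thesis
    using assms group_Lred image_Lred unfolding central_extension_def by simp
qed

end

text \<open>The carrier becomes smaller because \<open>a\<close> itself drops out, while the type
  and the map \<rho> stay the same; so the step can be iterated.\<close>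

lemma central_extension_reduce:
  fixes L :: "'b monoid"
  assumes "group G" "finite (carrier L)" "central_extension G L \<rho>"
    "\<not> kernel L G \<rho> \<subseteq> derived L (carrier L)"
  obtains K :: "'b monoid" where "carrier K \<subset> carrier L" "central_extension G K \<rho>"
    "kernel L G \<rho> \<inter> derived L (carrier L) \<subseteq> kernel K G \<rho> \<inter> derived K (carrier K)"
proof -
  interpret group_hom L G \<rho> using central_extension_hom assms by blast
  obtain a where a: "a \<in> kernel L G \<rho>" "a \<notin> derived L (carrier L)" using assms(4) by blast
  then have aL: "a \<in> carrier L" "\<rho> a = \<one>\<^bsub>G\<^esub>" by (auto simp: kernel_def)
  have ac: "a \<in> grp_center L" using a assms(3) by (auto simp: central_extension_def)
  obtain n :: int and \<psi> where psi: "n > 0" "\<forall>x. 0 \<le> \<psi> x \<and> \<psi> x < n"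
    "\<forall>x \<in> carrier L. \<forall>y \<in> carrier L. \<psi> (x \<otimes>\<^bsub>L\<^esub> y) = (\<psi> x + \<psi> y) mod n" "\<psi> a \<noteq> 0"
    using G.separating_character[OF assms(2) aL(1) a(2)] by metis
  interpret kr: kernel_reduction L G \<rho> \<psi> n a
    by unfold_locales (use psi aL ac in \<open>auto simp: grp_center_def\<close>)
  have "a \<notin> carrier kr.Lred" by (simp add: kr.carrier_Lred)
  then have "carrier kr.Lred \<subset> carrier L" using aL(1) kr.carrier_Lred by blast
  then show ?thesis using that kr.central_extension_Lred[OF assms(3)] kr.kernel_Lred by blast
qed

text \<open>Each reduction shrinks the carrier without losing any element of the intersection. When
  no reduction applies any more, the intersection is the whole kernel.\<close>

lemma exists_stem_extension:
  fixes L :: "'b monoid"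
  assumes "group G" "finite (carrier L)" "central_extension G L \<rho>"
  shows "\<exists>K :: 'b monoid. stem_extension G K \<rho> \<and> finite (carrier K) \<and>
    card (kernel L G \<rho> \<inter> derived L (carrier L)) \<le> card (kernel K G \<rho>)"
  using assms(2,3)
proof (induction "card (carrier L)" arbitrary: L rule: less_induct)
  case less
  show ?case
  proof (cases "kernel L G \<rho> \<subseteq> derived L (carrier L)")
    case True
    then have "stem_extension G L \<rho>"
      using less.prems unfolding central_extension_def stem_extension_def by simp
    moreover have "finite (kernel L G \<rho>)" using less.prems by (simp add: kernel_def)
    ultimately show ?thesis using less.prems card_mono by (metis Int_lower1)
  next
    case False
    obtain K :: "'b monoid" where K: "carrier K \<subset> carrier L" "central_extension G K \<rho>"
      "kernel L G \<rho> \<inter> derived L (carrier L) \<subseteq> kernel K G \<rho> \<inter> derived K (carrier K)"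
      using central_extension_reduce[OF assms(1) less.prems False] by metis
    have finK: "finite (carrier K)" using K(1) less.prems(1) finite_subset by blast
    have "card (carrier K) < card (carrier L)" using K(1) less.prems(1) psubset_card_mono by blast
    from less.hyps[OF this finK K(2)] obtain K' :: "'b monoid" where K': "stem_extension G K' \<rho>"
      "finite (carrier K')" "card (kernel K G \<rho> \<inter> derived K (carrier K)) \<le> card (kernel K' G \<rho>)" by blast
    have "finite (kernel K G \<rho> \<inter> derived K (carrier K))" using finK by (simp add: kernel_def)
    then have "card (kernel L G \<rho> \<inter> derived L (carrier L)) \<le> card (kernel K G \<rho> \<inter> derived K (carrier K))"
      using K(3) card_mono by blast
    then show ?thesis using K' le_trans by blast
  qed
qed

section \<open>Maximality of Schur covers\<close>

lemma card_central_extension: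
  assumes "group G" "central_extension G L \<rho>"
  shows "card (carrier L) = card (carrier G) * card (kernel L G \<rho>)"
proof -
  interpret group_hom L G \<rho> using central_extension_hom assms by blast
  have surj: "\<rho> ` carrier L = carrier G" using assms by (simp add: central_extension_def)
  have "bij_betw (\<lambda>c. the_elem (\<rho> ` c)) (carrier (L Mod kernel L G \<rho>)) (carrier G)"
    using FactGroup_iso_set[OF surj] by (simp add: iso_def)
  then have "card (rcosets\<^bsub>L\<^esub> kernel L G \<rho>) = card (carrier G)"
    using bij_betw_same_card by (fastforce simp: FactGroup_def)
  then show ?thesis using G.lagrange[OF subgroup_kernel] by (simp add: order_def)
qed

lemma stem_extension_central:
  "stem_extension G H \<pi> \<Longrightarrow> central_extension G H \<pi>"
  by (auto simp: stem_extension_def central_extension_def)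

text \<open>\<open>schur_cover\<close> compares only with competitors on \<open>nat\<close>; a
  finite stem extension on any type is transported there along an injection of its carrier.\<close>

lemma stem_extension_nat:
  fixes K :: "'b monoid"
  assumes G: "group G" and K: "stem_extension G K \<rho>" and fin: "finite (carrier K)"
  shows "\<exists>(N :: nat monoid) \<nu>. stem_extension G N \<nu> \<and> card (carrier N) = card (carrier K)"
proof -
  interpret group_hom K G \<rho>
    using central_extension_hom[OF G stem_extension_central[OF K]] .
  obtain f :: "'b \<Rightarrow> nat" where inj: "inj_on f (carrier K)"
    using finite_imp_inj_to_nat_seg[OF fin] by blast
  define N where "N = image_group f K"
  have carr: "carrier N = f ` carrier K" by (simp add: N_def image_group_carrier)
  have grp: "group N" unfolding N_def using G.inj_imp_image_group_is_group[OF inj] .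
  have iso: "f \<in> iso K N" unfolding N_def using inj_imp_image_group_iso[OF inj] .
  interpret f: group_hom K N f
    using iso grp by (simp add: iso_def group_hom_def group_hom_axioms_def)
  define \<nu> where "\<nu> = (\<lambda>n. \<rho> (inv_into (carrier K) f n))"
  have nu: "\<nu> (f x) = \<rho> x" if "x \<in> carrier K" for x using that inj by (simp add: \<nu>_def)
  have hom: "\<nu> \<in> hom N G"
  proof (rule homI)
    fix m n assume "m \<in> carrier N" "n \<in> carrier N"
    then obtain x y where xy: "x \<in> carrier K" "y \<in> carrier K" "m = f x" "n = f y" using carr by auto
    have "\<nu> (f x \<otimes>\<^bsub>N\<^esub> f y) = \<rho> (x \<otimes>\<^bsub>K\<^esub> y)"
      using nu[of "x \<otimes>\<^bsub>K\<^esub> y"] xy(1,2) f.hom_mult[OF xy(1,2)] by simp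
    then show "\<nu> (m \<otimes>\<^bsub>N\<^esub> n) = \<nu> m \<otimes>\<^bsub>G\<^esub> \<nu> n" using xy nu by simp
  qed (use carr nu in auto)
  have "\<nu> ` carrier N = \<rho> ` carrier K" unfolding carr image_image using nu by simp
  then have surj: "\<nu> ` carrier N = carrier G" using K by (simp add: stem_extension_def)
  have der: "derived N (carrier N) = f ` derived K (carrier K)"
    using f.derived_img[of "carrier K"] carr by simp
  have "kernel N G \<nu> \<subseteq> grp_center N \<inter> derived N (carrier N)"
  proof
    fix n assume "n \<in> kernel N G \<nu>"
    then obtain x where x: "x \<in> carrier K" "n = f x" "\<rho> x = \<one>\<^bsub>G\<^esub>" using carr nu by (auto simp: kernel_def)
    then have xd: "x \<in> grp_center K \<inter> derived K (carrier K)"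
      using K unfolding stem_extension_def kernel_def by blast
    have "f x \<otimes>\<^bsub>N\<^esub> m = m \<otimes>\<^bsub>N\<^esub> f x" if m: "m \<in> carrier N" for m
    proof -
      obtain y where y: "y \<in> carrier K" "m = f y" using m carr by auto
      have "x \<otimes>\<^bsub>K\<^esub> y = y \<otimes>\<^bsub>K\<^esub> x" using xd y(1) by (auto simp: grp_center_def)
      then show ?thesis using f.hom_mult[OF x(1) y(1)] f.hom_mult[OF y(1) x(1)] y(2) by simp
    qed
    then show "n \<in> grp_center N \<inter> derived N (carrier N)"
      using xd x carr unfolding der grp_center_def by blast
  qed
  then have "stem_extension G N \<nu>" using grp hom surj by (simp add: stem_extension_def)
  moreover have "card (carrier N) = card (carrier K)" unfolding carr using inj by (rule card_image)
  ultimately show ?thesis by blast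
qed

lemma schur_cover_central: "schur_cover G H \<pi> \<Longrightarrow> central_extension G H \<pi>"
  unfolding schur_cover_def using stem_extension_central by blast

text \<open>The form in which maximality is used. A stem extension obtained from \<open>L\<close> is
  moved to \<open>nat\<close> and compared in order with \<open>H\<close>; as both orders are
  multiples of the order of \<open>G\<close>, this compares the kernels.\<close>

lemma schur_cover_maximal:
  fixes L :: "'c monoid"
  assumes G: "group G" "finite (carrier G)" and H: "schur_cover G H \<pi>"
    and L: "central_extension G L \<rho>" "finite (carrier L)"
  shows "card (kernel L G \<rho> \<inter> derived L (carrier L)) \<le> card (kernel H G \<pi>)"
proof -
  obtain K :: "'c monoid" where K: "stem_extension G K \<rho>" "finite (carrier K)"
    "card (kernel L G \<rho> \<inter> derived L (carrier L)) \<le> card (kernel K G \<rho>)"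
    using exists_stem_extension[OF G(1) L(2,1)] by blast
  obtain N :: "nat monoid" and \<nu> where N: "stem_extension G N \<nu>" "card (carrier N) = card (carrier K)"
    using stem_extension_nat[OF G(1) K(1,2)] by blast
  have "card (carrier N) \<le> card (carrier H)" using H N unfolding schur_cover_def by blast
  then have "card (carrier G) * card (kernel K G \<rho>) \<le> card (carrier G) * card (kernel H G \<pi>)"
    using N(2) card_central_extension[OF G(1)] stem_extension_central[OF K(1)] schur_cover_central[OF H]
    by metis
  moreover have "card (carrier G) > 0"
    using G group.is_monoid monoid.one_closed by (metis card_gt_0_iff empty_iff)
  ultimately show ?thesis using K(3) by simp
qed

text \<open>It serves two purposes: the product of two extensions over a common base, and the
  pullback of an extension along a homomorphism, when the first argument is the new base.\<close>

definition fibre_product ::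
    "('b, 'm) monoid_scheme \<Rightarrow> ('c, 'n) monoid_scheme \<Rightarrow> ('b \<Rightarrow> 'a) \<Rightarrow> ('c \<Rightarrow> 'a) \<Rightarrow> ('b \<times> 'c) monoid" where
  "fibre_product H L \<pi> \<rho> = (H \<times>\<times> L)\<lparr>carrier := {(h, l). h \<in> carrier H \<and> l \<in> carrier L \<and> \<pi> h = \<rho> l}\<rparr>"

lemma fibre_product_simps:
  "z \<in> carrier (fibre_product H L \<pi> \<rho>) \<longleftrightarrow> fst z \<in> carrier H \<and> snd z \<in> carrier L \<and> \<pi> (fst z) = \<rho> (snd z)"
  "z \<otimes>\<^bsub>fibre_product H L \<pi> \<rho>\<^esub> w = (fst z \<otimes>\<^bsub>H\<^esub> fst w, snd z \<otimes>\<^bsub>L\<^esub> snd w)"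
  "\<one>\<^bsub>fibre_product H L \<pi> \<rho>\<^esub> = (\<one>\<^bsub>H\<^esub>, \<one>\<^bsub>L\<^esub>)"
  by (auto simp: fibre_product_def DirProd_def split: prod.splits)

lemma fibre_product_homs:
  assumes "group_hom H G \<pi>" "group_hom L G \<rho>"
  shows "group_hom (fibre_product H L \<pi> \<rho>) H fst" "group_hom (fibre_product H L \<pi> \<rho>) L snd"
proof -
  interpret H: group_hom H G \<pi> by fact
  interpret L: group_hom L G \<rho> by fact
  have "group (fibre_product H L \<pi> \<rho>)"
  proof (rule groupI)
    fix z assume z: "z \<in> carrier (fibre_product H L \<pi> \<rho>)"
    then show "\<exists>w \<in> carrier (fibre_product H L \<pi> \<rho>). w \<otimes>\<^bsub>fibre_product H L \<pi> \<rho>\<^esub> z = \<one>\<^bsub>fibre_product H L \<pi> \<rho>\<^esub>"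
      by (intro bexI[of _ "(inv\<^bsub>H\<^esub> fst z, inv\<^bsub>L\<^esub> snd z)"]) (simp_all add: fibre_product_simps)
  qed (simp_all add: fibre_product_simps H.G.m_assoc L.G.m_assoc)
  then show "group_hom (fibre_product H L \<pi> \<rho>) H fst" "group_hom (fibre_product H L \<pi> \<rho>) L snd"
    using H.G.is_group L.G.is_group
    by (auto simp: group_hom_def group_hom_axioms_def hom_def fibre_product_simps)
qed

lemma fibre_product_finite:
  assumes "finite (carrier H)" "finite (carrier L)"
  shows "finite (carrier (fibre_product H L \<pi> \<rho>))"
proof (rule finite_subset)
  show "carrier (fibre_product H L \<pi> \<rho>) \<subseteq> carrier H \<times> carrier L"
    by (auto simp: fibre_product_def)
qed (use assms in simp)

lemma central_extension_pullback:
  assumes "group G" "group_hom G P f" "central_extension P L \<rho>"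
  shows "central_extension G (fibre_product G L f \<rho>) fst"
proof -
  interpret f: group_hom G P f by fact
  have L: "group_hom L P \<rho>" using central_extension_hom assms(3) f.H.is_group by blast
  interpret F: group_hom "fibre_product G L f \<rho>" G fst
    using fibre_product_homs(1)[OF assms(2) L] .
  have "fst ` carrier (fibre_product G L f \<rho>) = carrier G"
  proof
    show "carrier G \<subseteq> fst ` carrier (fibre_product G L f \<rho>)"
    proof
      fix g assume g: "g \<in> carrier G"
      then have "f g \<in> \<rho> ` carrier L" using assms(3) by (simp add: central_extension_def)
      then obtain l where "l \<in> carrier L" "f g = \<rho> l" by blast
      then have "(g, l) \<in> carrier (fibre_product G L f \<rho>)" using g by (simp add: fibre_product_simps)
      then show "g \<in> fst ` carrier (fibre_product G L f \<rho>)" by force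
    qed
  qed (auto simp: fibre_product_simps)
  moreover have "kernel (fibre_product G L f \<rho>) G fst \<subseteq> grp_center (fibre_product G L f \<rho>)"
  proof
    fix z assume "z \<in> kernel (fibre_product G L f \<rho>) G fst"
    then have z: "z \<in> carrier (fibre_product G L f \<rho>)" "fst z = \<one>\<^bsub>G\<^esub>" by (simp_all add: kernel_def)
    then have "\<rho> (snd z) = \<one>\<^bsub>P\<^esub>" "snd z \<in> carrier L"
      by (metis f.hom_one fibre_product_simps(1))+
    then have "snd z \<in> grp_center L"
      using assms(3) unfolding central_extension_def kernel_def by blast
    then have "snd z \<otimes>\<^bsub>L\<^esub> l = l \<otimes>\<^bsub>L\<^esub> snd z" if "l \<in> carrier L" for l
      using that unfolding grp_center_def by blast
    then show "z \<in> grp_center (fibre_product G L f \<rho>)"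
      using z unfolding grp_center_def by (simp add: fibre_product_simps)
  qed
  ultimately show ?thesis
    using F.G.is_group F.homh unfolding central_extension_def by simp
qed

text \<open>The first projection is the pullback of \<open>L\<close> along \<pi>, which gives
  surjectivity. An element over the identity has both components in central kernels.\<close>

lemma central_extension_fibre_product:
  assumes "group G" "central_extension G H \<pi>" "central_extension G L \<rho>"
  shows "central_extension G (fibre_product H L \<pi> \<rho>) (\<lambda>z. \<pi> (fst z))"
proof -
  interpret H: group_hom H G \<pi> using central_extension_hom assms by blast
  have L: "group_hom L G \<rho>" using central_extension_hom assms by blast
  interpret F: group_hom "fibre_product H L \<pi> \<rho>" H fst
    using fibre_product_homs(1)[OF H.group_hom_axioms L] .
  have fst_surj: "fst ` carrier (fibre_product H L \<pi> \<rho>) = carrier H"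
    using central_extension_pullback[OF H.G.is_group H.group_hom_axioms assms(3)]
    by (simp add: central_extension_def)
  have "(\<lambda>z. \<pi> (fst z)) ` carrier (fibre_product H L \<pi> \<rho>) = \<pi> ` fst ` carrier (fibre_product H L \<pi> \<rho>)"
    by (simp add: image_image)
  also have "\<dots> = carrier G" unfolding fst_surj using assms(2) by (simp add: central_extension_def)
  finally have surj: "(\<lambda>z. \<pi> (fst z)) ` carrier (fibre_product H L \<pi> \<rho>) = carrier G" .
  have hom: "(\<lambda>z. \<pi> (fst z)) \<in> hom (fibre_product H L \<pi> \<rho>) G"
    using hom_compose[OF F.homh H.homh] by (simp add: comp_def)
  have "kernel (fibre_product H L \<pi> \<rho>) G (\<lambda>z. \<pi> (fst z)) \<subseteq> grp_center (fibre_product H L \<pi> \<rho>)"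
  proof
    fix z assume "z \<in> kernel (fibre_product H L \<pi> \<rho>) G (\<lambda>z. \<pi> (fst z))"
    then have z: "z \<in> carrier (fibre_product H L \<pi> \<rho>)" "\<pi> (fst z) = \<one>\<^bsub>G\<^esub>" by (simp_all add: kernel_def)
    then have "fst z \<in> kernel H G \<pi>" "snd z \<in> kernel L G \<rho>" by (auto simp: kernel_def fibre_product_simps)
    then have "fst z \<in> grp_center H" "snd z \<in> grp_center L"
      using assms(2,3) unfolding central_extension_def by blast+
    then have "\<forall>h \<in> carrier H. fst z \<otimes>\<^bsub>H\<^esub> h = h \<otimes>\<^bsub>H\<^esub> fst z"
      "\<forall>l \<in> carrier L. snd z \<otimes>\<^bsub>L\<^esub> l = l \<otimes>\<^bsub>L\<^esub> snd z"
      unfolding grp_center_def by blast+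
    then have "z \<otimes>\<^bsub>fibre_product H L \<pi> \<rho>\<^esub> w = w \<otimes>\<^bsub>fibre_product H L \<pi> \<rho>\<^esub> z"
      if "w \<in> carrier (fibre_product H L \<pi> \<rho>)" for w
      using that by (metis fibre_product_simps(1,2))
    then show "z \<in> grp_center (fibre_product H L \<pi> \<rho>)"
      using z(1) unfolding grp_center_def by blast
  qed
  then show ?thesis using hom surj F.G.is_group unfolding central_extension_def by simp
qed

text \<open>Let \<open>F\<close> be the fibre product and \<open>B\<close> the part of its derived
  subgroup over the identity of \<open>G\<close>. Derived subgroups map onto derived subgroups, so
  the first projection sends \<open>B\<close> onto a set containing the kernel of \<pi>. If
  \<open>l\<close> and \<open>l'\<close> did not commute, the commutator of (h, l) and (h', l')
  would be a nontrivial element of \<open>B\<close> with first component 1. Then \<open>B\<close>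
  would have more elements than the kernel of \<pi>, against
  \<open>schur_cover_maximal\<close>.\<close>

lemma schur_cover_commute:
  fixes H :: "'b monoid" and L :: "'c monoid"
  assumes G: "group G" "finite (carrier G)" and H: "schur_cover G H \<pi>"
    and L: "central_extension G L \<rho>" "finite (carrier L)"
    and h: "h \<in> carrier H" "h' \<in> carrier H" "h \<otimes>\<^bsub>H\<^esub> h' = h' \<otimes>\<^bsub>H\<^esub> h"
    and l: "l \<in> carrier L" "l' \<in> carrier L" and e: "\<pi> h = \<rho> l" "\<pi> h' = \<rho> l'"
  shows "l \<otimes>\<^bsub>L\<^esub> l' = l' \<otimes>\<^bsub>L\<^esub> l"
proof (rule ccontr)
  assume neq: "l \<otimes>\<^bsub>L\<^esub> l' \<noteq> l' \<otimes>\<^bsub>L\<^esub> l"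
  note Hc = schur_cover_central[OF H]
  interpret H: group_hom H G \<pi> using central_extension_hom[OF G(1) Hc] .
  interpret L: group_hom L G \<rho> using central_extension_hom[OF G(1) L(1)] .
  define F where "F = fibre_product H L \<pi> \<rho>"
  interpret f: group_hom F H fst
    unfolding F_def using fibre_product_homs(1)[OF H.group_hom_axioms L.group_hom_axioms] .
  interpret s: group_hom F L snd
    unfolding F_def using fibre_product_homs(2)[OF H.group_hom_axioms L.group_hom_axioms] .
  have finH: "finite (carrier H)" using H by (simp add: schur_cover_def)
  have finF: "finite (carrier F)" unfolding F_def using fibre_product_finite[OF finH L(2)] .
  define B where "B = kernel F G (\<lambda>z. \<pi> (fst z)) \<inter> derived F (carrier F)"
  have finB: "finite B" unfolding B_def kernel_def using finF by simp
  have "card B \<le> card (kernel H G \<pi>)"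
    unfolding B_def F_def
    using schur_cover_maximal[OF G H central_extension_fibre_product[OF G(1) Hc L(1)]] finF F_def by simp
  moreover have "kernel H G \<pi> \<subseteq> fst ` B"
  proof
    fix k assume k: "k \<in> kernel H G \<pi>"
    have "fst ` carrier F = carrier H"
      using central_extension_pullback[OF H.G.is_group H.group_hom_axioms L(1)]
      by (simp add: central_extension_def F_def)
    then have "derived H (carrier H) = fst ` derived F (carrier F)"
      using f.derived_img[of "carrier F"] by simp
    moreover have "k \<in> derived H (carrier H)"
      using k H unfolding schur_cover_def stem_extension_def by blast
    ultimately obtain z where z: "z \<in> derived F (carrier F)" "k = fst z" by blast
    have "z \<in> carrier F" using f.G.derived_in_carrier z(1) by blast
    then show "k \<in> fst ` B" using z k by (auto simp: B_def kernel_def)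
  qed
  moreover have "card (fst ` B) < card B"
  proof -
    define z where "z = (h, l)" define w where "w = (h', l')"
    have zw: "z \<in> carrier F" "w \<in> carrier F" using h l e by (simp_all add: z_def w_def F_def fibre_product_simps)
    define c where "c = z \<otimes>\<^bsub>F\<^esub> w \<otimes>\<^bsub>F\<^esub> inv\<^bsub>F\<^esub> z \<otimes>\<^bsub>F\<^esub> inv\<^bsub>F\<^esub> w"
    have cF: "c \<in> carrier F" using zw by (simp add: c_def)
    have "fst c = h \<otimes>\<^bsub>H\<^esub> h' \<otimes>\<^bsub>H\<^esub> inv\<^bsub>H\<^esub> h \<otimes>\<^bsub>H\<^esub> inv\<^bsub>H\<^esub> h'"
      using zw unfolding c_def by (simp add: z_def w_def)
    then have c1: "fst c = \<one>\<^bsub>H\<^esub>" using iffD2[OF H.G.commutator_one_iff[OF h(1,2)] h(3)] by simp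
    have "snd c = l \<otimes>\<^bsub>L\<^esub> l' \<otimes>\<^bsub>L\<^esub> inv\<^bsub>L\<^esub> l \<otimes>\<^bsub>L\<^esub> inv\<^bsub>L\<^esub> l'"
      using zw unfolding c_def by (simp add: z_def w_def)
    then have c2: "snd c \<noteq> \<one>\<^bsub>L\<^esub>" using L.G.commutator_one_iff[OF l] neq by simp
    have "c \<in> derived F (carrier F)" unfolding c_def using f.G.commutator_in_derived[OF zw] .
    then have cB: "c \<in> B" using cF c1 by (simp add: B_def kernel_def)
    have "\<one>\<^bsub>F\<^esub> \<in> derived F (carrier F)" using f.G.derived_is_subgroup subgroup.one_closed by blast
    then have oB: "\<one>\<^bsub>F\<^esub> \<in> B" by (simp add: B_def kernel_def)
    have "c \<noteq> \<one>\<^bsub>F\<^esub>" using c2 s.hom_one by auto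
    then have "\<not> inj_on fst B" using cB oB c1 f.hom_one unfolding inj_on_def by metis
    then show ?thesis using finB card_image_le[OF finB] eq_card_imp_inj_on[OF finB]
      by (metis le_neq_implies_less)
  qed
  moreover have "card (kernel H G \<pi>) \<le> card (fst ` B)"
    using calculation(2) finB by (intro card_mono) simp_all
  ultimately show False by simp
qed

section \<open>Nonabelian central extensions of noncyclic abelian groups\<close>

definition maximal_subgroup :: "'a set \<Rightarrow> ('a, 'm) monoid_scheme \<Rightarrow> bool" where
  "maximal_subgroup M P \<longleftrightarrow> subgroup M P \<and> M \<noteq> carrier P \<and>
     (\<forall>U. subgroup U P \<longrightarrow> M \<subseteq> U \<longrightarrow> U = M \<or> U = carrier P)"

lemma (in group) exists_maximal_subgroup:
  assumes "finite (carrier G)" "subgroup S G" "S \<noteq> carrier G"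
  shows "\<exists>M. maximal_subgroup M G \<and> S \<subseteq> M"
proof -
  let ?F = "{U. subgroup U G \<and> U \<noteq> carrier G}"
  have "?F \<subseteq> Pow (carrier G)" using subgroup.subset by blast
  then have "finite ?F" using assms(1) by (meson finite_Pow_iff finite_subset)
  moreover have "S \<in> ?F" using assms by simp
  ultimately obtain M where "M \<in> ?F" "S \<subseteq> M" "\<forall>U \<in> ?F. M \<subseteq> U \<longrightarrow> M = U"
    using finite_has_maximal2[of ?F S] by blast
  then show ?thesis unfolding maximal_subgroup_def by blast
qed

text \<open>By maximality the image of \<open>x\<close> generates the quotient by \<open>M\<close>.
  The order of this image is a power of \<open>p\<close> other than 1, so the discrete logarithm is
  well defined modulo \<open>p\<close>; it is 1 at \<open>x\<close> and 0 on
  \<open>M\<close>.\<close>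

lemma (in comm_group) maximal_subgroup_character:
  assumes p: "Factorial_Ring.prime p" "card (carrier G) = p ^ k"
    and M: "maximal_subgroup M G" and x: "x \<in> carrier G" "x \<notin> M"
  shows "\<exists>f :: 'a \<Rightarrow> int. (\<forall>u \<in> carrier G. \<forall>v \<in> carrier G. f (u \<otimes> v) mod int p = (f u + f v) mod int p) \<and>
    f x mod int p = 1 mod int p \<and> (\<forall>u \<in> M. f u mod int p = 0)"
proof -
  have Ms: "subgroup M G" using M by (simp add: maximal_subgroup_def)
  interpret M: normal M G using Ms by (rule subgroup_imp_normal)
  obtain T :: "'a set monoid" and q where hom: "group_hom G T q" and surj: "q ` carrier G = carrier T"
    and ker: "\<forall>z \<in> carrier G. q z = \<one>\<^bsub>T\<^esub> \<longleftrightarrow> z \<in> M"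
    using M.quotient_map by (elim exE conjE)
  interpret q: group_hom G T q by (rule hom)
  define t where "t = q x"
  have t: "t \<in> carrier T" using x t_def by simp
  have t1: "t \<noteq> \<one>\<^bsub>T\<^esub>" using x ker t_def by simp
  define R where "R = range (\<lambda>i::int. t [^]\<^bsub>T\<^esub> i)"
  have R: "subgroup R T" unfolding R_def using t by (rule q.H.subgroup_of_powers)
  define V where "V = {z \<in> carrier G. q z \<in> R}"
  have "subgroup V G"
  proof (rule subgroupI)
    have "\<one> \<in> V" unfolding V_def using subgroup.one_closed[OF R] by simp
    then show "V \<noteq> {}" by blast
  qed (use subgroup.m_closed[OF R] subgroup.m_inv_closed[OF R] in \<open>auto simp: V_def\<close>)
  moreover have "M \<subseteq> V"
  proof
    fix z assume z: "z \<in> M"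
    then have zG: "z \<in> carrier G" by (rule M.mem_carrier)
    then have "q z = \<one>\<^bsub>T\<^esub>" using ker z by blast
    then show "z \<in> V" unfolding V_def using zG subgroup.one_closed[OF R] by simp
  qed
  moreover have "x \<in> V"
  proof -
    have "t [^]\<^bsub>T\<^esub> (1::int) \<in> R" unfolding R_def by (rule rangeI)
    then show ?thesis unfolding V_def using x t t_def by simp
  qed
  ultimately have V: "V = carrier G" using M x(2) unfolding maximal_subgroup_def by blast
  have gen: "\<forall>y \<in> carrier T. \<exists>i::int. y = t [^]\<^bsub>T\<^esub> i"
  proof
    fix y assume "y \<in> carrier T"
    then have "y \<in> q ` carrier G" using surj by simp
    then obtain z where z: "z \<in> carrier G" "y = q z" by blast
    then have "z \<in> V" using V by simp
    then have "y \<in> R" using z(2) unfolding V_def by simp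
    then show "\<exists>i::int. y = t [^]\<^bsub>T\<^esub> i" unfolding R_def by blast
  qed
  obtain f where f: "\<forall>y \<in> carrier T. y = t [^]\<^bsub>T\<^esub> (f y :: int)"
    "\<forall>y \<in> carrier T. \<forall>z \<in> carrier T. int (q.H.ord t) dvd f y + f z - f (y \<otimes>\<^bsub>T\<^esub> z)"
    using q.H.cyclic_coordinate[OF t gen] by metis
  have "x [^] (p ^ k) = \<one>" using pow_order_eq_1[OF x(1)] p(2) by (simp add: order_def)
  then have "t [^]\<^bsub>T\<^esub> (p ^ k) = \<one>\<^bsub>T\<^esub>" unfolding t_def using q.hom_nat_pow[OF x(1), of "p ^ k"] by (metis q.hom_one)
  then have "q.H.ord t dvd p ^ k" using q.H.pow_eq_id[OF t] by simp
  moreover have "q.H.ord t \<noteq> 1" using q.H.ord_eq_1[OF t] t1 by simp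
  ultimately have "p dvd q.H.ord t" using p(1) by (metis divides_primepow_nat dvd_power gr0I power_0)
  then have pdvd: "int p dvd int (q.H.ord t)" by simp
  have "f (q (u \<otimes> v)) mod int p = (f (q u) + f (q v)) mod int p" if "u \<in> carrier G" "v \<in> carrier G" for u v
  proof -
    have "int (q.H.ord t) dvd f (q u) + f (q v) - f (q (u \<otimes> v))" using f(2) that by simp
    then have "int p dvd f (q u) + f (q v) - f (q (u \<otimes> v))" using pdvd dvd_trans by blast
    then show ?thesis using mod_eq_dvd_iff by metis
  qed
  moreover have "f (q x) mod int p = 1 mod int p"
  proof -
    have "t [^]\<^bsub>T\<^esub> (1::int) = t [^]\<^bsub>T\<^esub> f t" using f(1) t by simp
    then have "int (q.H.ord t) dvd f t - 1" using q.H.int_pow_eq[OF t] by blast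
    then have "int p dvd f t - 1" using pdvd dvd_trans by blast
    then show ?thesis unfolding t_def[symmetric] by (simp add: mod_eq_dvd_iff)
  qed
  moreover have "f (q u) mod int p = 0" if u: "u \<in> M" for u
  proof -
    have "q u = \<one>\<^bsub>T\<^esub>" using ker u M.mem_carrier by blast
    then have "t [^]\<^bsub>T\<^esub> f (q u) = \<one>\<^bsub>T\<^esub>" using f(1) by (metis q.H.one_closed)
    then have "int (q.H.ord t) dvd f (q u)" using q.H.int_pow_eq_id[OF t] by blast
    then show ?thesis using pdvd dvd_trans by (metis mod_eq_0_iff_dvd)
  qed
  ultimately show ?thesis by (intro exI[of _ "\<lambda>u. f (q u)"]) blast
qed

text \<open>A construction of Heisenberg type: f(u) g(v) is bilinear modulo \<open>p\<close>, hence
  a 2-cocycle, and \<open>E\<close> is the extension by the integers modulo \<open>p\<close> that it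
  defines. Two elements over u and v commute exactly if f(u) g(v) = f(v) g(u) modulo
  \<open>p\<close>.\<close>

lemma (in comm_group) bilinear_extension:
  fixes f g :: "'a \<Rightarrow> int"
  assumes fin: "finite (carrier G)" and p: "p > 0"
    and f: "\<And>u v. u \<in> carrier G \<Longrightarrow> v \<in> carrier G \<Longrightarrow> f (u \<otimes> v) mod p = (f u + f v) mod p"
    and g: "\<And>u v. u \<in> carrier G \<Longrightarrow> v \<in> carrier G \<Longrightarrow> g (u \<otimes> v) mod p = (g u + g v) mod p"
  defines "E \<equiv> \<lparr>carrier = carrier G \<times> {0..<p},
    monoid.mult = (\<lambda>z w. (fst z \<otimes> fst w, (snd z + snd w + f (fst z) * g (fst w)) mod p)), one = (\<one>, 0)\<rparr>"
  shows "central_extension G E fst" "finite (carrier E)"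
proof -
  have carr: "z \<in> carrier E \<longleftrightarrow> fst z \<in> carrier G \<and> 0 \<le> snd z \<and> snd z < p" for z
    by (cases z) (auto simp: E_def)
  have mult: "z \<otimes>\<^bsub>E\<^esub> w = (fst z \<otimes> fst w, (snd z + snd w + f (fst z) * g (fst w)) mod p)" for z w
    by (simp add: E_def)
  have one: "\<one>\<^bsub>E\<^esub> = (\<one>, 0)" by (simp add: E_def)
  have f1: "p dvd f \<one>" and g1: "p dvd g \<one>"
    using f[of \<one> \<one>] g[of \<one> \<one>] by (auto simp: mod_eq_dvd_iff)
  have absorb: "(b + c) mod p = b mod p" if "p dvd c" for b c :: int
    using that mod_add_right_eq[of b c p] by simp
  have grp: "group E"
  proof (rule groupI)
    fix z w u assume z: "z \<in> carrier E" and w: "w \<in> carrier E" and u: "u \<in> carrier E"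
    let ?a = "fst z" and ?b = "fst w" and ?c = "fst u"
    have G: "?a \<in> carrier G" "?b \<in> carrier G" "?c \<in> carrier G" using z w u by (simp_all add: carr)
    have "((snd z + snd w + f ?a * g ?b) mod p + snd u + f (?a \<otimes> ?b) * g ?c) mod p
        = ((snd z + snd w + f ?a * g ?b) + snd u + (f ?a + f ?b) * g ?c) mod p"
      using f[OF G(1,2)] by (intro mod_add_cong mod_mult_cong) simp_all
    moreover have "(snd z + (snd w + snd u + f ?b * g ?c) mod p + f ?a * g (?b \<otimes> ?c)) mod p
        = (snd z + (snd w + snd u + f ?b * g ?c) + f ?a * (g ?b + g ?c)) mod p"
      using g[OF G(2,3)] by (intro mod_add_cong mod_mult_cong) simp_all
    moreover have "(snd z + snd w + f ?a * g ?b) + snd u + (f ?a + f ?b) * g ?c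
        = snd z + (snd w + snd u + f ?b * g ?c) + f ?a * (g ?b + g ?c)" by (simp add: algebra_simps)
    ultimately show "z \<otimes>\<^bsub>E\<^esub> w \<otimes>\<^bsub>E\<^esub> u = z \<otimes>\<^bsub>E\<^esub> (w \<otimes>\<^bsub>E\<^esub> u)"
      unfolding mult using G by (simp add: m_assoc)
  next
    fix z assume z: "z \<in> carrier E"
    then have "(snd z + f \<one> * g (fst z)) mod p = snd z" using absorb[of "f \<one> * g (fst z)" "snd z"] f1 by (simp add: carr)
    then show "\<one>\<^bsub>E\<^esub> \<otimes>\<^bsub>E\<^esub> z = z" using z by (simp add: mult one carr)
    \<comment> \<open>The second component is chosen to cancel the cocycle term of the product with
      \<open>z\<close>.\<close>
    define y where "y = (inv (fst z), (- snd z - f (inv (fst z)) * g (fst z)) mod p)"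
    have "y \<otimes>\<^bsub>E\<^esub> z = \<one>\<^bsub>E\<^esub>"
    proof -
      have "((- snd z - f (inv (fst z)) * g (fst z)) mod p + (snd z + f (inv (fst z)) * g (fst z))) mod p = 0"
        unfolding mod_add_left_eq by simp
      then show ?thesis using z by (simp add: y_def mult one carr add.assoc)
    qed
    moreover have "y \<in> carrier E" using z p by (simp add: y_def carr)
    ultimately show "\<exists>y \<in> carrier E. y \<otimes>\<^bsub>E\<^esub> z = \<one>\<^bsub>E\<^esub>" by blast
  qed (use p in \<open>auto simp: carr mult one\<close>)
  have "fst ` carrier E = carrier G" using p by (simp add: E_def)
  moreover have "kernel E G fst \<subseteq> grp_center E"
  proof
    fix k assume "k \<in> kernel E G fst"
    then have k: "k \<in> carrier E" "fst k = \<one>" by (simp_all add: kernel_def)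
    have "k \<otimes>\<^bsub>E\<^esub> z = z \<otimes>\<^bsub>E\<^esub> k" if "z \<in> carrier E" for z
    proof -
      have "(snd k + snd z + f \<one> * g (fst z)) mod p = (snd z + snd k + f (fst z) * g \<one>) mod p"
        using absorb[of "f \<one> * g (fst z)" "snd k + snd z"] absorb[of "f (fst z) * g \<one>" "snd z + snd k"] f1 g1
        by (simp add: add.commute)
      then show ?thesis using that k by (simp add: mult carr)
    qed
    then show "k \<in> grp_center E" using k by (simp add: grp_center_def)
  qed
  moreover have "fst \<in> hom E G" by (auto simp: hom_def carr mult)
  ultimately show "central_extension G E fst" using grp by (simp add: central_extension_def)
  show "finite (carrier E)" using fin by (simp add: E_def)
qed

text \<open>Take a maximal subgroup \<open>M\<close> and \<open>x\<close> outside it. Since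
  \<open>x\<close> does not generate, it lies in a maximal subgroup \<open>N\<close>; take
  \<open>y\<close> in \<open>M\<close> outside \<open>N\<close>. Characters that vanish on
  \<open>M\<close> and on \<open>N\<close>, with value 1 at \<open>x\<close> and at \<open>y\<close>
  respectively, give f(x) g(y) = 1 and f(y) g(x) = 0, so lifts of \<open>x\<close> and
  \<open>y\<close> do not commute.\<close>

lemma (in comm_group) exists_nonabelian_extension:
  assumes fin: "finite (carrier G)" and p: "Factorial_Ring.prime p" "card (carrier G) = p ^ k"
    and nc: "\<not> cyclic_group G"
  shows "\<exists>(E :: ('a \<times> int) monoid) \<rho>. central_extension G E \<rho> \<and> finite (carrier E) \<and>
    (\<exists>z \<in> carrier E. \<exists>w \<in> carrier E. z \<otimes>\<^bsub>E\<^esub> w \<noteq> w \<otimes>\<^bsub>E\<^esub> z)"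
proof -
  have powers: "range (\<lambda>i::int. x [^] i) \<noteq> carrier G" if "x \<in> carrier G" for x
    using nc that cyclic_group by auto
  have "subgroup {\<one>} G" by (rule triv_subgroup)
  moreover have "{\<one>} \<noteq> carrier G" using powers[OF one_closed] by auto
  ultimately obtain M where M: "maximal_subgroup M G" using exists_maximal_subgroup[OF fin] by blast
  have Ms: "subgroup M G" "M \<noteq> carrier G" using M by (simp_all add: maximal_subgroup_def)
  obtain x where x: "x \<in> carrier G" "x \<notin> M" using Ms subgroup.subset by blast
  obtain N where N: "maximal_subgroup N G" "range (\<lambda>i::int. x [^] i) \<subseteq> N"
    using exists_maximal_subgroup[OF fin subgroup_of_powers[OF x(1)] powers[OF x(1)]] by blast
  have "x [^] (1::int) \<in> N" using N(2) by blast
  then have xN: "x \<in> N" using x by simp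
  \<comment> \<open>Otherwise maximality of \<open>M\<close> would give N = M, although
    \<open>x\<close> lies in \<open>N\<close> and not in \<open>M\<close>.\<close>
  have "\<not> M \<subseteq> N" using M N(1) xN x(2) unfolding maximal_subgroup_def by blast
  then obtain y where y: "y \<in> M" "y \<notin> N" by blast
  have yG: "y \<in> carrier G" using y(1) Ms(1) subgroup.subset by blast
  obtain f :: "'a \<Rightarrow> int" where f: "\<forall>u \<in> carrier G. \<forall>v \<in> carrier G. f (u \<otimes> v) mod int p = (f u + f v) mod int p"
    "f x mod int p = 1 mod int p" "\<forall>u \<in> M. f u mod int p = 0"
    using maximal_subgroup_character[OF p M x] by blast
  obtain g :: "'a \<Rightarrow> int" where g: "\<forall>u \<in> carrier G. \<forall>v \<in> carrier G. g (u \<otimes> v) mod int p = (g u + g v) mod int p"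
    "g y mod int p = 1 mod int p" "\<forall>u \<in> N. g u mod int p = 0"
    using maximal_subgroup_character[OF p N(1) yG y(2)] by blast
  have p1: "int p > 1" using p(1) prime_gt_1_nat by simp
  define E :: "('a \<times> int) monoid" where "E = \<lparr>carrier = carrier G \<times> {0..<int p},
    monoid.mult = (\<lambda>z w. (fst z \<otimes> fst w, (snd z + snd w + f (fst z) * g (fst w)) mod int p)), one = (\<one>, 0)\<rparr>"
  have E: "central_extension G E fst" "finite (carrier E)"
    unfolding E_def using p1 f(1) g(1) by (intro bilinear_extension[OF fin]; simp)+
  have "(f x * g y) mod int p = (1 * 1) mod int p" using f(2) g(2) by (rule mod_mult_cong)
  moreover have "(f y * g x) mod int p = (0 * 0) mod int p"
    using f(3) g(3) y(1) xN by (intro mod_mult_cong) simp_all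
  ultimately have "(f x * g y) mod int p \<noteq> (f y * g x) mod int p" using p1 by simp
  then have "(x, 0) \<otimes>\<^bsub>E\<^esub> (y, 0) \<noteq> (y, 0) \<otimes>\<^bsub>E\<^esub> (x, 0)" by (simp add: E_def)
  moreover have "(x, 0) \<in> carrier E" "(y, 0) \<in> carrier E" using x yG p1 by (simp_all add: E_def)
  ultimately show ?thesis using E by blast
qed

section \<open>Decomposition of nilpotent groups\<close>

lemma prime_power_split:
  assumes "Factorial_Ring.prime (p::nat)" "n > 0"
  obtains m where "n = p ^ multiplicity p n * m" "coprime p m" "m > 0"
proof
  let ?m = "n div p ^ multiplicity p n"
  show e: "n = p ^ multiplicity p n * ?m" using multiplicity_dvd[of p n] by simp
  have "\<not> p dvd ?m" using multiplicity_decompose[of n p] assms prime_gt_1_nat[OF assms(1)] by simp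
  then show "coprime p ?m" using assms(1) by (simp add: prime_imp_coprime)
  show "?m > 0" using e assms(2) by (metis gr0I mult_0_right)
qed

lemma (in group) subgroup_pow_card:
  assumes "subgroup U G" "u \<in> U"
  shows "u [^] card U = \<one>"
proof -
  interpret U: group "G\<lparr>carrier := U\<rparr>" using subgroup_imp_group[OF assms(1)] .
  show ?thesis using U.pow_order_eq_1[of u] assms(2) nat_pow_consistent by (simp add: order_def)
qed

lemma (in group) commuting_product:
  assumes U: "subgroup U G" and V: "subgroup V G"
    and comm: "\<And>u v. u \<in> U \<Longrightarrow> v \<in> V \<Longrightarrow> u \<otimes> v = v \<otimes> u" and disj: "U \<inter> V \<subseteq> {\<one>}"
  shows "subgroup ((\<lambda>(u, v). u \<otimes> v) ` (U \<times> V)) G"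
    "card ((\<lambda>(u, v). u \<otimes> v) ` (U \<times> V)) = card U * card V"
proof -
  have UG: "u \<in> carrier G" if "u \<in> U" for u using that U subgroup.subset by blast
  have VG: "v \<in> carrier G" if "v \<in> V" for v using that V subgroup.subset by blast
  let ?W = "(\<lambda>(u, v). u \<otimes> v) ` (U \<times> V)"
  have W: "u \<otimes> v \<in> ?W" if "u \<in> U" "v \<in> V" for u v using that by force
  show "subgroup ?W G"
  proof (rule subgroupI)
    show "?W \<subseteq> carrier G" using UG VG by auto
    have "\<one> \<otimes> \<one> \<in> ?W" using W subgroup.one_closed U V by blast
    then show "?W \<noteq> {}" by blast
  next
    fix w assume "w \<in> ?W"
    then obtain u v where uv: "u \<in> U" "v \<in> V" "w = u \<otimes> v" by auto
    have "inv w = inv v \<otimes> inv u" using uv UG VG by (simp add: inv_mult_group)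
    also have "\<dots> = inv u \<otimes> inv v"
      using comm[of "inv u" "inv v"] subgroup.m_inv_closed[OF U uv(1)] subgroup.m_inv_closed[OF V uv(2)] by simp
    finally show "inv w \<in> ?W" using W subgroup.m_inv_closed[OF U uv(1)] subgroup.m_inv_closed[OF V uv(2)] by simp
  next
    fix w w' assume "w \<in> ?W" "w' \<in> ?W"
    then obtain u v u' v' where uv: "u \<in> U" "v \<in> V" "w = u \<otimes> v" "u' \<in> U" "v' \<in> V" "w' = u' \<otimes> v'"
      by auto
    have "w \<otimes> w' = u \<otimes> (v \<otimes> u') \<otimes> v'" using uv UG VG by (simp add: m_assoc)
    also have "v \<otimes> u' = u' \<otimes> v" using comm[OF uv(4,2)] by (rule sym)
    also have "u \<otimes> (u' \<otimes> v) \<otimes> v' = (u \<otimes> u') \<otimes> (v \<otimes> v')" using uv UG VG by (simp add: m_assoc)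
    finally show "w \<otimes> w' \<in> ?W"
      using W subgroup.m_closed[OF U uv(1,4)] subgroup.m_closed[OF V uv(2,5)] by simp
  qed
  have "inj_on (\<lambda>(u, v). u \<otimes> v) (U \<times> V)"
  proof (rule inj_onI, clarify)
    fix u v u' v' assume a: "u \<in> U" "v \<in> V" "u' \<in> U" "v' \<in> V" "u \<otimes> v = u' \<otimes> v'"
    have G: "u \<in> carrier G" "v \<in> carrier G" "u' \<in> carrier G" "v' \<in> carrier G"
      using a UG VG by simp_all
    have "inv u' \<otimes> (u \<otimes> v) \<otimes> inv v = inv u' \<otimes> (u' \<otimes> v') \<otimes> inv v" using a(5) by simp
    moreover have "inv u' \<otimes> (u \<otimes> v) \<otimes> inv v = inv u' \<otimes> u" using G by (simp add: m_assoc)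
    moreover have "inv u' \<otimes> (u' \<otimes> v') \<otimes> inv v = v' \<otimes> inv v" using G by (simp flip: m_assoc)
    ultimately have e: "inv u' \<otimes> u = v' \<otimes> inv v" by simp
    have "inv u' \<otimes> u \<in> U" using a U subgroup.m_closed subgroup.m_inv_closed by metis
    moreover have "v' \<otimes> inv v \<in> V" using a V subgroup.m_closed subgroup.m_inv_closed by metis
    ultimately have "inv u' \<otimes> u = \<one>" "v' \<otimes> inv v = \<one>" using disj e by auto
    then show "u = u' \<and> v = v'" using G by (metis inv_equality inv_inv inv_closed)
  qed
  then show "card ?W = card U * card V" by (simp add: card_image card_cartesian_product)
qed

lemma (in group) coprime_product:
  assumes cc: "coprime_commute G" and U: "subgroup U G" and V: "subgroup V G"
    and cop: "coprime (card U) (card V)"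
  shows "subgroup ((\<lambda>(u, v). u \<otimes> v) ` (U \<times> V)) G"
    "card ((\<lambda>(u, v). u \<otimes> v) ` (U \<times> V)) = card U * card V"
    "\<And>u v. u \<in> U \<Longrightarrow> v \<in> V \<Longrightarrow> u \<otimes> v = v \<otimes> u"
proof -
  show comm: "u \<otimes> v = v \<otimes> u" if "u \<in> U" "v \<in> V" for u v
    using coprime_commuteD[OF cc _ _ cop] subgroup_pow_card[OF U that(1)] subgroup_pow_card[OF V that(2)]
      subgroup.mem_carrier[OF U that(1)] subgroup.mem_carrier[OF V that(2)] by blast
  have "U \<inter> V \<subseteq> {\<one>}"
  proof
    fix x assume "x \<in> U \<inter> V"
    then have "x \<in> carrier G" "x [^] card U = \<one>" "x [^] card V = \<one>"
      using subgroup_pow_card U V subgroup.subset by blast+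
    then show "x \<in> {\<one>}" using coprime_pow_eq_one cop by blast
  qed
  from commuting_product[OF U V comm this]
  show "subgroup ((\<lambda>(u, v). u \<otimes> v) ` (U \<times> V)) G"
    "card ((\<lambda>(u, v). u \<otimes> v) ` (U \<times> V)) = card U * card V" by auto
qed

text \<open>Induction on \<open>d\<close>: split off the full power of one prime, realise it by
  Sylow's theorem, and multiply with the subgroup for the remaining factor. Elements of the two
  factors commute by coprimality, so the product is a subgroup.\<close>

lemma (in group) exists_hall_subgroup:
  assumes fin: "finite (carrier G)" and cc: "coprime_commute G"
    and "order G = d * e" "coprime d e"
  shows "\<exists>K. subgroup K G \<and> card K = d"
  using assms(3,4)
proof (induction d arbitrary: e rule: less_induct)
  case (less d)
  have d0: "d > 0" using less.prems(1) fin order_gt_0_iff_finite by (metis gr0I mult_0)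
  show ?case
  proof (cases "d = 1")
    case True
    then show ?thesis using triv_subgroup by (intro exI[of _ "{\<one>}"]) simp
  next
    case False
    then obtain q where q: "Factorial_Ring.prime q" "q dvd d" using prime_factor_nat by blast
    obtain t where t: "d = q ^ multiplicity q d * t" "coprime q t" "t > 0"
      using prime_power_split[OF q(1) d0] by blast
    define s where "s = multiplicity q d"
    have ds: "d = q ^ s * t" using t(1) s_def by simp
    have "s > 0" using q d0 by (simp add: s_def prime_multiplicity_gt_zero_iff)
    then have "q ^ s > 1" using q(1) prime_gt_1_nat one_less_power by blast
    then have td: "t < d" using ds t(3) by simp
    have o: "order G = t * (q ^ s * e)" "order G = q ^ s * (t * e)" using less.prems(1) ds by simp_all
    have cop: "coprime t (q ^ s)" using t(2) by (simp add: coprime_commute)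
    moreover have "coprime t e" using less.prems(2) ds by simp
    ultimately obtain K where K: "subgroup K G" "card K = t"
      using less.IH[OF td o(1)] by auto
    obtain Q where Q: "subgroup Q G" "card Q = q ^ s"
      using sylow_thm[OF q(1) is_group o(2) fin] by blast
    have "coprime (card K) (card Q)" using cop K Q by simp
    from coprime_product[OF cc K(1) Q(1) this] show ?thesis
      using K(2) Q(2) ds by (intro exI[of _ "(\<lambda>(u, v). u \<otimes> v) ` (K \<times> Q)"]) (simp add: mult.commute)
  qed
qed

text \<open>The group is the commuting product of \<open>P\<close> and a subgroup \<open>K\<close>
  of order \<open>m\<close>. The retraction is the power map with an exponent that is 1 modulo the
  order of \<open>P\<close> and 0 modulo \<open>m\<close>: it fixes \<open>P\<close> and kills
  \<open>K\<close>.\<close>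

lemma (in group) exists_retraction:
  assumes fin: "finite (carrier G)" and cc: "coprime_commute G"
    and P: "subgroup P G" and o: "order G = card P * m" and cop: "coprime (card P) m"
  shows "\<exists>r. r \<in> hom G (G\<lparr>carrier := P\<rparr>) \<and> (\<forall>u \<in> P. r u = u) \<and>
    (\<forall>g \<in> carrier G. \<exists>k \<in> carrier G. k [^] m = \<one> \<and> g = r g \<otimes> k)"
proof -
  have PG: "u \<in> carrier G" if "u \<in> P" for u using that P subgroup.subset by blast
  obtain K where K: "subgroup K G" "card K = m"
    using exists_hall_subgroup[OF fin cc, of m "card P"] o cop by (auto simp: mult.commute coprime_commute)
  have KG: "u \<in> carrier G" if "u \<in> K" for u using that K subgroup.subset by blast
  have "coprime (card P) (card K)" using cop K(2) by simp
  note prod = coprime_product[OF cc P K(1) this]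
  have "(\<lambda>(u, v). u \<otimes> v) ` (P \<times> K) = carrier G"
    using card_subset_eq[OF fin subgroup.subset[OF prod(1)]] prod(2) K(2) o by (simp add: order_def)
  then have dec: "\<exists>u \<in> P. \<exists>k \<in> K. g = u \<otimes> k" if "g \<in> carrier G" for g using that by force
  have m0: "m \<noteq> 0" using o fin order_gt_0_iff_finite by (metis mult_0_right less_numeral_extra(3))
  obtain a b where ab: "m * a = card P * b + 1" using bezout_nat[OF m0, of "card P"] cop
    by (auto simp: coprime_commute coprime_iff_gcd_eq_1)
  define r where "r g = g [^] (m * a)" for g
  have rP: "r u = u" if "u \<in> P" for u
  proof -
    have "u [^] (card P * b + 1) = (u [^] card P) [^] b \<otimes> u"
      using PG[OF that] by (simp add: nat_pow_pow flip: nat_pow_mult)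
    then show ?thesis unfolding r_def ab using subgroup_pow_card[OF P that] PG[OF that] by simp
  qed
  have rK: "r k = \<one>" if "k \<in> K" for k
    unfolding r_def using subgroup_pow_card[OF K(1) that] K(2) KG[OF that] by (metis nat_pow_one nat_pow_pow)
  have r: "r (u \<otimes> k) = u" if "u \<in> P" "k \<in> K" for u k
  proof -
    have "r (u \<otimes> k) = r u \<otimes> r k"
      unfolding r_def using pow_mult_distrib[OF prod(3)[OF that] PG[OF that(1)] KG[OF that(2)]] .
    then show ?thesis using rP rK that PG by simp
  qed
  have "r \<in> hom G (G\<lparr>carrier := P\<rparr>)"
  proof (rule homI)
    fix g assume "g \<in> carrier G"
    then show "r g \<in> carrier (G\<lparr>carrier := P\<rparr>)" using dec r by fastforce
  next
    fix g h assume "g \<in> carrier G" "h \<in> carrier G"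
    then obtain u k v l where d: "u \<in> P" "k \<in> K" "g = u \<otimes> k" "v \<in> P" "l \<in> K" "h = v \<otimes> l"
      using dec by metis
    have "g \<otimes> h = u \<otimes> (k \<otimes> v) \<otimes> l" using d PG KG by (simp add: m_assoc)
    also have "k \<otimes> v = v \<otimes> k" using prod(3) d by simp
    also have "u \<otimes> (v \<otimes> k) \<otimes> l = (u \<otimes> v) \<otimes> (k \<otimes> l)" using d PG KG by (simp add: m_assoc)
    finally have "r (g \<otimes> h) = u \<otimes> v"
      using r subgroup.m_closed[OF P d(1,4)] subgroup.m_closed[OF K(1) d(2,5)] by simp
    then show "r (g \<otimes> h) = r g \<otimes>\<^bsub>G\<lparr>carrier := P\<rparr>\<^esub> r h" using r d by simp
  qed
  moreover have "\<exists>k \<in> carrier G. k [^] m = \<one> \<and> g = r g \<otimes> k" if g: "g \<in> carrier G" for g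
  proof -
    obtain u k where d: "u \<in> P" "k \<in> K" "g = u \<otimes> k" using dec[OF g] by blast
    then show ?thesis using r subgroup_pow_card[OF K(1) d(2)] K(2) KG by (intro bexI[of _ k]) simp_all
  qed
  ultimately show ?thesis using rP by blast
qed

text \<open>Write g = r(g) h with h^m = 1. Both \<open>g\<close> and r(g) have p-power order and the
  factors commute, so \<open>h\<close> has p-power order as well; hence h = 1. In particular the
  Sylow subgroup of each prime is unique.\<close>

lemma (in group) sylow_contains_torsion:
  assumes fin: "finite (carrier G)" and cc: "coprime_commute G" and p: "Factorial_Ring.prime p"
    and P: "subgroup P G" and cP: "card P = p ^ k" and o: "order G = p ^ k * m" and cop: "coprime p m"
    and g: "g \<in> carrier G" "g [^] (p ^ j) = \<one>"
  shows "g \<in> P"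
proof -
  have cop': "coprime (card P) m" using cP cop by simp
  obtain r where r: "r \<in> hom G (G\<lparr>carrier := P\<rparr>)" "\<forall>u \<in> P. r u = u"
    "\<forall>g \<in> carrier G. \<exists>k \<in> carrier G. k [^] m = \<one> \<and> g = r g \<otimes> k"
    using exists_retraction[OF fin cc P _ cop'] o cP by auto
  obtain h where h: "h \<in> carrier G" "h [^] m = \<one>" "g = r g \<otimes> h" using r(3) g(1) by blast
  have rP: "r g \<in> P" using r(1) g(1) by (auto simp: hom_def)
  then have rG: "r g \<in> carrier G" using P subgroup.subset by blast
  have rp: "r g [^] (p ^ k) = \<one>" using subgroup_pow_card[OF P rP] cP by simp
  have "coprime (p ^ k) m" using cop by simp
  then have c: "r g \<otimes> h = h \<otimes> r g" using coprime_commuteD[OF cc rG h(1) _ rp h(2)] by simp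
  have "g [^] (p ^ (j + k)) = \<one>" using g by (simp add: power_add flip: nat_pow_pow)
  moreover have "g [^] (p ^ (j + k)) = r g [^] (p ^ (j + k)) \<otimes> h [^] (p ^ (j + k))"
    using pow_mult_distrib[OF c rG h(1)] h(3) by metis
  moreover have "r g [^] (p ^ (j + k)) = \<one>"
  proof -
    have "r g [^] (p ^ k * p ^ j) = \<one>" using rp rG by (simp flip: nat_pow_pow)
    then show ?thesis by (simp add: power_add mult.commute)
  qed
  ultimately have "h [^] (p ^ (j + k)) = \<one>" using h(1) by simp
  moreover have "coprime m (p ^ (j + k))" using cop by (simp add: coprime_commute)
  ultimately have "h = \<one>" using coprime_pow_eq_one h(1,2) by blast
  then show ?thesis using h(3) rP rG by simp
qed

section \<open>Deep commuting graphs\<close>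

lemma (in group) order_prime_split:
  assumes fin: "finite (carrier G)" and p: "Factorial_Ring.prime p"
  obtains i m where "order G = p ^ i * m" "coprime p m"
  using prime_power_split[OF p, of "order G"] fin order_gt_0_iff_finite by metis

locale finite_cover = group_hom H G \<pi> for H :: "'b monoid" and G :: "'a monoid" and \<pi> +
  assumes ext: "central_extension G H \<pi>"
    and finG: "finite (carrier G)" and finH: "finite (carrier H)"
    and ccG: "coprime_commute G"
begin

lemma ccH: "coprime_commute H"
  using coprime_commute_central_extension[OF H.is_group ccG ext] .

lemma kernel_central: "z \<in> carrier H \<Longrightarrow> \<pi> z = \<one>\<^bsub>G\<^esub> \<Longrightarrow> z \<in> grp_center H"
  using ext unfolding central_extension_def kernel_def by blast

lemma lift: "x \<in> carrier G \<Longrightarrow> \<exists>a \<in> carrier H. \<pi> a = x"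
  using ext unfolding central_extension_def by (metis imageE)

lemma center_commute: "z \<in> grp_center H \<Longrightarrow> x \<in> carrier H \<Longrightarrow> z \<otimes>\<^bsub>H\<^esub> x = x \<otimes>\<^bsub>H\<^esub> z"
  unfolding grp_center_def by blast

lemma commute_cong_left:
  assumes a: "a \<in> carrier H" "a' \<in> carrier H" "inv\<^bsub>H\<^esub> a \<otimes>\<^bsub>H\<^esub> a' \<in> grp_center H"
    and b: "b \<in> carrier H" and c: "a \<otimes>\<^bsub>H\<^esub> b = b \<otimes>\<^bsub>H\<^esub> a"
  shows "a' \<otimes>\<^bsub>H\<^esub> b = b \<otimes>\<^bsub>H\<^esub> a'"
proof -
  have "a \<otimes>\<^bsub>H\<^esub> (inv\<^bsub>H\<^esub> a \<otimes>\<^bsub>H\<^esub> a') \<otimes>\<^bsub>H\<^esub> b = b \<otimes>\<^bsub>H\<^esub> (a \<otimes>\<^bsub>H\<^esub> (inv\<^bsub>H\<^esub> a \<otimes>\<^bsub>H\<^esub> a'))"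
    using G.commute_mult[OF a(1) _ b c center_commute[OF a(3) b]] a by simp
  moreover have "a \<otimes>\<^bsub>H\<^esub> (inv\<^bsub>H\<^esub> a \<otimes>\<^bsub>H\<^esub> a') = a'" using a(1,2) by (simp flip: G.m_assoc)
  ultimately show ?thesis by simp
qed

text \<open>Two lifts of one element differ by a kernel element, which is central. So the
  quantifiers over all lifts in \<open>deep_adj\<close> can be tested on a single pair.\<close>

lemma lift_commute:
  assumes a: "a \<in> carrier H" "a' \<in> carrier H" "\<pi> a = \<pi> a'"
    and b: "b \<in> carrier H" "b' \<in> carrier H" "\<pi> b = \<pi> b'"
    and c: "a \<otimes>\<^bsub>H\<^esub> b = b \<otimes>\<^bsub>H\<^esub> a"
  shows "a' \<otimes>\<^bsub>H\<^esub> b' = b' \<otimes>\<^bsub>H\<^esub> a'"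
proof -
  have "inv\<^bsub>H\<^esub> a \<otimes>\<^bsub>H\<^esub> a' \<in> grp_center H" using a by (intro kernel_central) auto
  then have "a' \<otimes>\<^bsub>H\<^esub> b = b \<otimes>\<^bsub>H\<^esub> a'" by (rule commute_cong_left[OF a(1,2) _ b(1) c])
  moreover have "inv\<^bsub>H\<^esub> b \<otimes>\<^bsub>H\<^esub> b' \<in> grp_center H" using b by (intro kernel_central) auto
  ultimately show ?thesis using commute_cong_left[OF b(1,2) _ a(2)] by simp
qed

text \<open>The reflexive companion of \<open>deep_adj\<close>; it spares case distinctions on equal
  vertices.\<close>

definition commuting_lifts :: "'a \<Rightarrow> 'a \<Rightarrow> bool" where
  "commuting_lifts x y \<longleftrightarrow> (\<forall>a \<in> carrier H. \<forall>b \<in> carrier H. \<pi> a = x \<longrightarrow> \<pi> b = y \<longrightarrow>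
     a \<otimes>\<^bsub>H\<^esub> b = b \<otimes>\<^bsub>H\<^esub> a)"

lemma deep_adj_iff: "deep_adj H \<pi> x y \<longleftrightarrow> x \<noteq> y \<and> commuting_lifts x y"
  unfolding deep_adj_def commuting_lifts_def by blast

lemma commuting_lifts_iff:
  assumes "a \<in> carrier H" "b \<in> carrier H"
  shows "commuting_lifts (\<pi> a) (\<pi> b) \<longleftrightarrow> a \<otimes>\<^bsub>H\<^esub> b = b \<otimes>\<^bsub>H\<^esub> a"
  using assms lift_commute unfolding commuting_lifts_def by metis

lemma commuting_lifts_refl: "commuting_lifts x x"
  unfolding commuting_lifts_def using lift_commute by metis

text \<open>This lets paths in the reduced graph be built from noncentral elements of
  \<open>H\<close>.\<close>

lemma reduced_vertices_iff:
  assumes a: "a \<in> carrier H"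
  shows "\<pi> a \<in> reduced_vertices (carrier G) (deep_adj H \<pi>) \<longleftrightarrow> a \<notin> grp_center H"
proof -
  have "dominant (carrier G) (deep_adj H \<pi>) (\<pi> a) \<longleftrightarrow> (\<forall>w \<in> carrier G. commuting_lifts (\<pi> a) w)"
    unfolding dominant_def deep_adj_iff using a commuting_lifts_refl by auto
  also have "\<dots> \<longleftrightarrow> (\<forall>b \<in> carrier H. commuting_lifts (\<pi> a) (\<pi> b))"
    using lift by (metis hom_closed)
  also have "\<dots> \<longleftrightarrow> a \<in> grp_center H" using commuting_lifts_iff a by (simp add: grp_center_def)
  finally show ?thesis using a by (simp add: reduced_vertices_def)
qed

lemma commuting_path:
  assumes "a \<in> carrier H" "b \<in> carrier H" "a \<notin> grp_center H" "b \<notin> grp_center H"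
    "a \<otimes>\<^bsub>H\<^esub> b = b \<otimes>\<^bsub>H\<^esub> a"
  defines "V \<equiv> reduced_vertices (carrier G) (deep_adj H \<pi>)"
  shows "(\<lambda>x y. x \<in> V \<and> y \<in> V \<and> deep_adj H \<pi> x y)\<^sup>*\<^sup>* (\<pi> a) (\<pi> b)"
proof (cases "\<pi> a = \<pi> b")
  case False
  then have "deep_adj H \<pi> (\<pi> a) (\<pi> b)" using assms commuting_lifts_iff deep_adj_iff by simp
  then show ?thesis using assms reduced_vertices_iff by (intro r_into_rtranclp) simp
qed simp

text \<open>Every vertex is joined to the image of \<open>u\<close>. For noncentral
  \<open>a\<close>, at least one of the coprime powers a^m and a^(p^e) is noncentral, where the
  order of \<open>H\<close> is p^e m. If a^m is, it has p-power order and commutes with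
  \<open>v\<close>, giving the path a, a^m, v, u. Otherwise a^(p^e) has exponent prime to
  \<open>p\<close> and commutes with \<open>u\<close>.\<close>

lemma reduced_connected_of_two_primes:
  assumes p: "Factorial_Ring.prime (p::nat)" and q: "Factorial_Ring.prime q" and "p \<noteq> q"
    and u: "u \<in> carrier H" "u \<notin> grp_center H" "u [^]\<^bsub>H\<^esub> (p ^ i) = \<one>\<^bsub>H\<^esub>"
    and v: "v \<in> carrier H" "v \<notin> grp_center H" "v [^]\<^bsub>H\<^esub> (q ^ j) = \<one>\<^bsub>H\<^esub>"
  shows "reduced_connected (carrier G) (deep_adj H \<pi>)"
proof -
  define V where "V = reduced_vertices (carrier G) (deep_adj H \<pi>)"
  define R where "R = (\<lambda>x y. x \<in> V \<and> y \<in> V \<and> deep_adj H \<pi> x y)\<^sup>*\<^sup>*"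
  have path: "R (\<pi> a) (\<pi> b)" if "a \<in> carrier H" "b \<in> carrier H" "a \<notin> grp_center H"
    "b \<notin> grp_center H" "a \<otimes>\<^bsub>H\<^esub> b = b \<otimes>\<^bsub>H\<^esub> a" for a b
    unfolding R_def V_def using commuting_path that by blast
  have trans: "R x z" if "R x y" "R y z" for x y z
    using that unfolding R_def by (rule rtranclp_trans)
  have cpq: "coprime p q" using assms(1-3) by (simp add: primes_coprime)
  obtain e m where em: "order H = p ^ e * m" "coprime p m" using G.order_prime_split[OF finH p] by metis
  have uv: "u \<otimes>\<^bsub>H\<^esub> v = v \<otimes>\<^bsub>H\<^esub> u"
    using coprime_commuteD[OF ccH u(1) v(1) _ u(3) v(3)] cpq by simp
  have to_u: "R (\<pi> a) (\<pi> u) \<and> R (\<pi> u) (\<pi> a)" if a: "a \<in> carrier H" "a \<notin> grp_center H" for a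
  proof -
    have pe: "(a [^]\<^bsub>H\<^esub> m) [^]\<^bsub>H\<^esub> (p ^ e) = \<one>\<^bsub>H\<^esub>" "(a [^]\<^bsub>H\<^esub> (p ^ e)) [^]\<^bsub>H\<^esub> m = \<one>\<^bsub>H\<^esub>"
      using G.pow_order_eq_1[OF a(1)] a(1) em(1) by (simp_all add: G.nat_pow_pow mult.commute)
    have comm: "a \<otimes>\<^bsub>H\<^esub> a [^]\<^bsub>H\<^esub> k = a [^]\<^bsub>H\<^esub> k \<otimes>\<^bsub>H\<^esub> a" for k :: nat
      using a(1) G.nat_pow_comm[of a 1 k] by simp
    show ?thesis
    proof (cases "a [^]\<^bsub>H\<^esub> m \<in> grp_center H")
      case False
      have "a [^]\<^bsub>H\<^esub> m \<otimes>\<^bsub>H\<^esub> v = v \<otimes>\<^bsub>H\<^esub> a [^]\<^bsub>H\<^esub> m"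
        using coprime_commuteD[OF ccH _ v(1) _ pe(1) v(3)] a cpq by simp
      then have "R (\<pi> a) (\<pi> (a [^]\<^bsub>H\<^esub> m))" "R (\<pi> (a [^]\<^bsub>H\<^esub> m)) (\<pi> v)" "R (\<pi> v) (\<pi> u)"
        "R (\<pi> (a [^]\<^bsub>H\<^esub> m)) (\<pi> a)" "R (\<pi> v) (\<pi> (a [^]\<^bsub>H\<^esub> m))" "R (\<pi> u) (\<pi> v)"
        using False a u(1,2) v(1,2) uv comm[of m] by (intro path; simp)+
      then show ?thesis using trans by meson
    next
      case True
      have "coprime m (p ^ e)" using em(2) by (simp add: coprime_commute)
      then have nc: "a [^]\<^bsub>H\<^esub> (p ^ e) \<notin> grp_center H"
        using G.subgroup_coprime_pow[OF G.center_subgroup a(1) True] a(2) by blast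
      have "coprime m (p ^ i)" using em(2) by (simp add: coprime_commute)
      then have "a [^]\<^bsub>H\<^esub> (p ^ e) \<otimes>\<^bsub>H\<^esub> u = u \<otimes>\<^bsub>H\<^esub> a [^]\<^bsub>H\<^esub> (p ^ e)"
        using coprime_commuteD[OF ccH _ u(1) _ pe(2) u(3)] a by simp
      then have "R (\<pi> a) (\<pi> (a [^]\<^bsub>H\<^esub> (p ^ e)))" "R (\<pi> (a [^]\<^bsub>H\<^esub> (p ^ e))) (\<pi> u)"
        "R (\<pi> (a [^]\<^bsub>H\<^esub> (p ^ e))) (\<pi> a)" "R (\<pi> u) (\<pi> (a [^]\<^bsub>H\<^esub> (p ^ e)))"
        using nc a u(1,2) comm[of "p ^ e"] by (intro path; simp)+
      then show ?thesis using trans by meson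
    qed
  qed
  have "R x y" if "x \<in> V" "y \<in> V" for x y
  proof -
    have "x \<in> carrier G" "y \<in> carrier G" using that by (simp_all add: V_def reduced_vertices_def)
    then obtain a b where ab: "a \<in> carrier H" "\<pi> a = x" "b \<in> carrier H" "\<pi> b = y" using lift by metis
    then have "a \<notin> grp_center H" "b \<notin> grp_center H" using reduced_vertices_iff that V_def by metis+
    then show ?thesis using to_u ab trans by metis
  qed
  then show ?thesis unfolding reduced_connected_def graph_connected_def R_def V_def by blast
qed

text \<open>Raise an arbitrary lift to a multiple of the p'-part of the order of \<open>H\<close>
  that is 1 modulo p^k: the image stays \<open>x\<close> and the lift becomes p-torsion.\<close>

lemma torsion_lift:
  assumes p: "Factorial_Ring.prime (p::nat)" and x: "x \<in> carrier G" "x [^]\<^bsub>G\<^esub> (p ^ k) = \<one>\<^bsub>G\<^esub>"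
  obtains a i where "a \<in> carrier H" "\<pi> a = x" "a [^]\<^bsub>H\<^esub> (p ^ i) = \<one>\<^bsub>H\<^esub>"
proof -
  obtain i m where im: "order H = p ^ i * m" "coprime p m" using G.order_prime_split[OF finH p] by metis
  obtain a where a: "a \<in> carrier H" "\<pi> a = x" using lift x(1) by blast
  have "m \<noteq> 0" using im(1) finH G.order_gt_0_iff_finite by (metis mult_0_right less_numeral_extra(3))
  moreover have "coprime m (p ^ k)" using im(2) by (simp add: coprime_commute)
  ultimately obtain c d where cd: "m * c = p ^ k * d + 1"
    using bezout_nat[of m "p ^ k"] by (auto simp: coprime_iff_gcd_eq_1)
  have "x [^]\<^bsub>G\<^esub> (p ^ k * d + 1) = (x [^]\<^bsub>G\<^esub> (p ^ k)) [^]\<^bsub>G\<^esub> d \<otimes>\<^bsub>G\<^esub> x"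
    using x(1) by (simp add: H.nat_pow_pow flip: H.nat_pow_mult)
  then have "\<pi> (a [^]\<^bsub>H\<^esub> (m * c)) = x" using a x cd by (simp add: hom_nat_pow)
  moreover have "(a [^]\<^bsub>H\<^esub> (m * c)) [^]\<^bsub>H\<^esub> (p ^ i) = (a [^]\<^bsub>H\<^esub> order H) [^]\<^bsub>H\<^esub> c"
    using a(1) im(1) by (simp add: G.nat_pow_pow mult_ac)
  then have "(a [^]\<^bsub>H\<^esub> (m * c)) [^]\<^bsub>H\<^esub> (p ^ i) = \<one>\<^bsub>H\<^esub>" using a(1) G.pow_order_eq_1 by simp
  ultimately show ?thesis using that a(1) by blast
qed

text \<open>Two q-torsion elements of \<open>H\<close> lie over powers of \<open>t\<close>, and
  powers of one lift of \<open>t\<close> commute, so they commute by \<open>lift_commute\<close>.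
  With elements of exponent prime to \<open>q\<close> the element \<open>u\<close> commutes anyway;
  Bezout on two coprime powers of \<open>b\<close> covers every \<open>b\<close>.\<close>

lemma torsion_central_of_cyclic:
  assumes q: "Factorial_Ring.prime (q::nat)" and t: "t \<in> carrier G"
    and cyc: "\<And>x n. x \<in> carrier G \<Longrightarrow> x [^]\<^bsub>G\<^esub> (q ^ n) = \<one>\<^bsub>G\<^esub> \<Longrightarrow> \<exists>i::int. x = t [^]\<^bsub>G\<^esub> i"
    and u: "u \<in> carrier H" "u [^]\<^bsub>H\<^esub> (q ^ j) = \<one>\<^bsub>H\<^esub>"
  shows "u \<in> grp_center H"
proof -
  obtain w where w: "w \<in> carrier H" "\<pi> w = t" using lift t by blast
  have powers: "\<exists>i::int. \<pi> v = \<pi> (w [^]\<^bsub>H\<^esub> i)" if v: "v \<in> carrier H" "v [^]\<^bsub>H\<^esub> (q ^ n) = \<one>\<^bsub>H\<^esub>" for v n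
  proof -
    have "\<pi> v [^]\<^bsub>G\<^esub> (q ^ n) = \<one>\<^bsub>G\<^esub>" using v by (metis hom_nat_pow hom_one)
    then show ?thesis using cyc[of "\<pi> v" n] v(1) w by (simp add: hom_int_pow)
  qed
  have torsion: "v \<otimes>\<^bsub>H\<^esub> u = u \<otimes>\<^bsub>H\<^esub> v" if v: "v \<in> carrier H" "v [^]\<^bsub>H\<^esub> (q ^ n) = \<one>\<^bsub>H\<^esub>" for v n
  proof -
    obtain i :: int where i: "\<pi> v = \<pi> (w [^]\<^bsub>H\<^esub> i)" using powers[OF v] by blast
    obtain l :: int where l: "\<pi> u = \<pi> (w [^]\<^bsub>H\<^esub> l)" using powers[OF u] by blast
    have "w [^]\<^bsub>H\<^esub> i \<otimes>\<^bsub>H\<^esub> w [^]\<^bsub>H\<^esub> l = w [^]\<^bsub>H\<^esub> l \<otimes>\<^bsub>H\<^esub> w [^]\<^bsub>H\<^esub> i"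
      unfolding G.int_pow_mult[OF w(1), symmetric] by (simp add: add.commute)
    then show ?thesis using lift_commute[OF _ v(1) i[symmetric] _ u(1) l[symmetric]] w(1) by simp
  qed
  obtain e m where em: "order H = q ^ e * m" "coprime q m" using G.order_prime_split[OF finH q] by metis
  have "b \<in> {x \<in> carrier H. x \<otimes>\<^bsub>H\<^esub> u = u \<otimes>\<^bsub>H\<^esub> x}" if b: "b \<in> carrier H" for b
  proof (rule G.subgroup_coprime_pow[OF G.centralizer_subgroup[OF u(1)] b])
    have pe: "(b [^]\<^bsub>H\<^esub> m) [^]\<^bsub>H\<^esub> (q ^ e) = \<one>\<^bsub>H\<^esub>" "(b [^]\<^bsub>H\<^esub> (q ^ e)) [^]\<^bsub>H\<^esub> m = \<one>\<^bsub>H\<^esub>"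
      using G.pow_order_eq_1[OF b] b em(1) by (simp_all add: G.nat_pow_pow mult.commute)
    show "b [^]\<^bsub>H\<^esub> m \<in> {x \<in> carrier H. x \<otimes>\<^bsub>H\<^esub> u = u \<otimes>\<^bsub>H\<^esub> x}" using torsion[OF _ pe(1)] b by simp
    have "coprime m (q ^ j)" using em(2) by (simp add: coprime_commute)
    then show "b [^]\<^bsub>H\<^esub> (q ^ e) \<in> {x \<in> carrier H. x \<otimes>\<^bsub>H\<^esub> u = u \<otimes>\<^bsub>H\<^esub> x}"
      using coprime_commuteD[OF ccH _ u(1) _ pe(2) u(2)] b by simp
    show "coprime m (q ^ e)" using em(2) by (simp add: coprime_commute)
  qed
  then show ?thesis using u(1) unfolding grp_center_def by auto
qed

text \<open>Induction on the exponent: for n = q^s t, the power a^t is q-torsion and a^(q^s) has the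
  smaller exponent t. Both are central, and the exponents are coprime.\<close>

lemma coprime_torsion_central:
  assumes p: "Factorial_Ring.prime (p::nat)"
    and q: "\<And>(q::nat) u j. Factorial_Ring.prime q \<Longrightarrow> q \<noteq> p \<Longrightarrow> u \<in> carrier H \<Longrightarrow>
      u [^]\<^bsub>H\<^esub> (q ^ j) = \<one>\<^bsub>H\<^esub> \<Longrightarrow> u \<in> grp_center H"
    and a: "a \<in> carrier H" "a [^]\<^bsub>H\<^esub> n = \<one>\<^bsub>H\<^esub>" "coprime p n"
  shows "a \<in> grp_center H"
  using a
proof (induction n arbitrary: a rule: less_induct)
  case (less n)
  have n0: "n > 0" using less.prems(3) p by (metis coprime_0_right_iff gr0I not_prime_unit)
  show ?case
  proof (cases "n = 1")
    case True
    then show ?thesis using less.prems(1,2) subgroup.one_closed[OF G.center_subgroup] by simp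
  next
    case False
    then obtain q' where q': "Factorial_Ring.prime q'" "q' dvd n" using prime_factor_nat by blast
    obtain t where t: "n = q' ^ multiplicity q' n * t" "coprime q' t" "t > 0"
      using prime_power_split[OF q'(1) n0] by blast
    define s where "s = multiplicity q' n"
    have ns: "n = q' ^ s * t" using t(1) s_def by simp
    have "s > 0" using q' n0 by (simp add: s_def prime_multiplicity_gt_zero_iff)
    then have "q' ^ s > 1" using q'(1) prime_gt_1_nat one_less_power by blast
    then have tn: "t < n" using ns t(3) by simp
    have "q' \<noteq> p" using q'(2) less.prems(3) p by (metis coprime_common_divisor_nat dvd_refl not_prime_1)
    then have "a [^]\<^bsub>H\<^esub> t \<in> grp_center H"
      using q[OF q'(1), of "a [^]\<^bsub>H\<^esub> t" s] less.prems(1,2) ns by (simp add: G.nat_pow_pow mult.commute)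
    moreover have "a [^]\<^bsub>H\<^esub> (q' ^ s) \<in> grp_center H"
      using less.IH[OF tn, of "a [^]\<^bsub>H\<^esub> (q' ^ s)"] less.prems ns by (simp add: G.nat_pow_pow)
    moreover have "coprime t (q' ^ s)" using t(2) by (simp add: coprime_commute)
    ultimately show ?thesis using G.subgroup_coprime_pow[OF G.center_subgroup less.prems(1)] by blast
  qed
qed

end

text \<open>\<open>C\<close> and \<open>D\<close> are reflexive versions of the adjacencies.
  \<open>C\<close> depends only on images under \<open>r\<close>, so each vertex v is related to r v
  and the larger graph is a blow-up of the smaller one. Paths go down by applying \<open>r\<close>,
  and go up unchanged with one step attached at either end.\<close>

lemma reduced_connected_retract:
  assumes WV: "W \<subseteq> V" and r: "\<And>v. v \<in> V \<Longrightarrow> r v \<in> W" "\<And>w. w \<in> W \<Longrightarrow> r w = w"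
    and E: "\<And>x y. E x y \<longleftrightarrow> x \<noteq> y \<and> C x y" and F: "\<And>x y. F x y \<longleftrightarrow> x \<noteq> y \<and> D x y"
    and CD: "\<And>x y. x \<in> V \<Longrightarrow> y \<in> V \<Longrightarrow> C x y \<longleftrightarrow> D (r x) (r y)" and Drefl: "\<And>x. D x x"
  shows "reduced_connected V E \<longleftrightarrow> reduced_connected W F"
proof -
  define V' where "V' = reduced_vertices V E"
  define W' where "W' = reduced_vertices W F"
  have Crefl: "C v v" if "v \<in> V" for v using CD[OF that that] Drefl by simp
  have V': "v \<in> V' \<longleftrightarrow> v \<in> V \<and> (\<exists>w \<in> V. \<not> C v w)" for v
    unfolding V'_def reduced_vertices_def dominant_def E mem_Collect_eq using Crefl by metis
  have W': "v \<in> W' \<longleftrightarrow> v \<in> W \<and> (\<exists>w \<in> W. \<not> D v w)" for v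
    unfolding W'_def reduced_vertices_def dominant_def F mem_Collect_eq using Drefl by metis
  have red: "v \<in> V' \<longleftrightarrow> r v \<in> W'" if v: "v \<in> V" for v
    unfolding V' W' using v CD r WV by (metis subsetD)
  have W'V': "w \<in> V'" if "w \<in> W'" for w
    using that red[of w] r(2)[of w] WV W' by auto
  let ?RE = "\<lambda>x y. x \<in> V' \<and> y \<in> V' \<and> E x y" and ?RF = "\<lambda>x y. x \<in> W' \<and> y \<in> W' \<and> F x y"
  have step: "?RE\<^sup>*\<^sup>* x y" if "x \<in> V'" "y \<in> V'" "C x y" for x y
    using that E by (cases "x = y") auto
  have down: "?RF\<^sup>*\<^sup>* (r x) (r y)" if "?RE\<^sup>*\<^sup>* x y" for x y
    using that
  proof induction
    case (step y z)
    then have st: "y \<in> V'" "z \<in> V'" "E y z" by simp_all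
    then have V: "y \<in> V" "z \<in> V" using V' by simp_all
    then have "r y \<in> W'" "r z \<in> W'" using red st by blast+
    moreover have "D (r y) (r z)" using CD[OF V] E st(3) by blast
    ultimately have "?RF\<^sup>*\<^sup>* (r y) (r z)" using F by (cases "r y = r z") auto
    then show ?case using step.IH by (rule rtranclp_trans[rotated])
  qed simp
  have up: "?RE\<^sup>*\<^sup>* x y" if "?RF\<^sup>*\<^sup>* x y" for x y
    using that
  proof induction
    case (step y z)
    then have "y \<in> W" "z \<in> W" "y \<in> V'" "z \<in> V'" "D y z" using W' W'V' F by auto
    then have "E y z" using E F CD r(2) WV step.hyps(2) by (metis subsetD)
    then show ?case using \<open>y \<in> V'\<close> \<open>z \<in> V'\<close> by (intro rtranclp.rtrancl_into_rtrancl[OF step.IH]) simp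
  qed simp
  have "graph_connected V' E \<longleftrightarrow> graph_connected W' F"
  proof
    assume c: "graph_connected V' E"
    show "graph_connected W' F"
      unfolding graph_connected_def
    proof (intro ballI)
      fix x y assume xy: "x \<in> W'" "y \<in> W'"
      then have "?RE\<^sup>*\<^sup>* x y" using c W'V' unfolding graph_connected_def by blast
      then show "?RF\<^sup>*\<^sup>* x y" using down[of x y] r(2) xy W' by simp
    qed
  next
    assume c: "graph_connected W' F"
    show "graph_connected V' E"
      unfolding graph_connected_def
    proof (intro ballI)
      fix x y assume xy: "x \<in> V'" "y \<in> V'"
      then have V: "x \<in> V" "y \<in> V" using V' by auto
      then have rW: "r x \<in> W'" "r y \<in> W'" using red xy by auto
      then have "?RE\<^sup>*\<^sup>* (r x) (r y)" using c up unfolding graph_connected_def by blast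
      moreover have "C x (r x)" "C (r y) y"
        using CD[of x "r x"] CD[of "r y" y] V r Drefl WV by auto
      then have "?RE\<^sup>*\<^sup>* x (r x)" "?RE\<^sup>*\<^sup>* (r y) y" using step xy rW W'V' by auto
      ultimately show "?RE\<^sup>*\<^sup>* x y" by (meson rtranclp_trans)
    qed
  qed
  then show ?thesis unfolding reduced_connected_def V'_def W'_def .
qed


text \<open>If all p-torsion of \<open>H\<close> were central, every element of \<open>P\<close>
  would have a central lift and \<open>P\<close> would be abelian. Being noncyclic, it has a
  nonabelian central extension \<open>E\<close>; pulled back to \<open>G\<close> along the
  retraction, \<open>E\<close> would have to be commutative by
  \<open>schur_cover_commute\<close>.\<close>

lemma noncyclic_sylow_torsion:
  fixes G :: "'a monoid" and H :: "'b monoid"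
  assumes G: "group G" "finite (carrier G)" "coprime_commute G" and H: "schur_cover G H \<pi>"
    and p: "Factorial_Ring.prime (p::nat)" and P: "subgroup P G" "card P = p ^ k"
    and o: "order G = p ^ k * m" "coprime p m" and nc: "\<not> cyclic_group (G\<lparr>carrier := P\<rparr>)"
  shows "\<exists>u i. u \<in> carrier H \<and> u \<notin> grp_center H \<and> u [^]\<^bsub>H\<^esub> (p ^ i) = \<one>\<^bsub>H\<^esub>"
proof (rule ccontr)
  assume no: "\<nexists>u i. u \<in> carrier H \<and> u \<notin> grp_center H \<and> u [^]\<^bsub>H\<^esub> (p ^ i) = \<one>\<^bsub>H\<^esub>"
  have ext: "central_extension G H \<pi>" using schur_cover_central[OF H] .
  interpret finite_cover H G \<pi>
    using central_extension_hom[OF G(1) ext] ext G H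
    by (simp add: finite_cover_def finite_cover_axioms_def schur_cover_def)
  have lifts: "\<exists>a \<in> grp_center H. \<pi> a = x" if x: "x \<in> P" for x
  proof -
    have "x [^]\<^bsub>G\<^esub> (p ^ k) = \<one>\<^bsub>G\<^esub>" using H.subgroup_pow_card[OF P(1) x] P(2) by simp
    then obtain a i where "a \<in> carrier H" "\<pi> a = x" "a [^]\<^bsub>H\<^esub> (p ^ i) = \<one>\<^bsub>H\<^esub>"
      using torsion_lift[OF p] subgroup.mem_carrier[OF P(1) x] by metis
    then show ?thesis using no by blast
  qed
  let ?P = "G\<lparr>carrier := P\<rparr>"
  interpret P: group ?P using H.subgroup_imp_group[OF P(1)] .
  have "comm_group ?P"
  proof (rule P.group_comm_groupI)
    fix x y assume "x \<in> carrier ?P" "y \<in> carrier ?P"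
    then obtain a b where ab: "a \<in> grp_center H" "\<pi> a = x" "b \<in> grp_center H" "\<pi> b = y"
      using lifts by auto metis
    have "a \<in> carrier H" "b \<in> carrier H" using ab by (simp_all add: grp_center_def)
    then have "\<pi> a \<otimes>\<^bsub>G\<^esub> \<pi> b = \<pi> b \<otimes>\<^bsub>G\<^esub> \<pi> a"
      using center_commute[OF ab(1)] hom_mult by metis
    then show "x \<otimes>\<^bsub>?P\<^esub> y = y \<otimes>\<^bsub>?P\<^esub> x" using ab by simp
  qed
  then interpret P: comm_group ?P .
  have finP: "finite P" using P(1) G(2) finite_subset subgroup.subset by blast
  obtain E :: "('a \<times> int) monoid" and \<rho> where E: "central_extension ?P E \<rho>" "finite (carrier E)"
    and nab: "\<exists>z \<in> carrier E. \<exists>w \<in> carrier E. z \<otimes>\<^bsub>E\<^esub> w \<noteq> w \<otimes>\<^bsub>E\<^esub> z"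
    using P.exists_nonabelian_extension[OF _ p _ nc, of k] finP P(2) by auto
  have "coprime (card P) m" using P(2) o(2) by simp
  then obtain r where r: "r \<in> hom G ?P" "\<forall>u \<in> P. r u = u"
    using H.exists_retraction[OF G(2,3) P(1), of m] o(1) P(2) by auto
  have rh: "group_hom G ?P r"
    using r(1) G(1) P.is_group by (simp add: group_hom_def group_hom_axioms_def)
  let ?L = "fibre_product G E r \<rho>"
  have L: "central_extension G ?L fst" by (rule central_extension_pullback[OF G(1) rh E(1)])
  have finL: "finite (carrier ?L)" by (rule fibre_product_finite[OF G(2) E(2)])
  obtain z w where zw: "z \<in> carrier E" "w \<in> carrier E" "z \<otimes>\<^bsub>E\<^esub> w \<noteq> w \<otimes>\<^bsub>E\<^esub> z" using nab by blast
  have "\<rho> ` carrier E = P" using E(1) by (simp add: central_extension_def)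
  then have xy: "\<rho> z \<in> P" "\<rho> w \<in> P" using zw by auto
  then have xyG: "\<rho> z \<in> carrier G" "\<rho> w \<in> carrier G" using P(1) subgroup.subset by blast+
  obtain a b where ab: "a \<in> grp_center H" "\<pi> a = \<rho> z" "b \<in> grp_center H" "\<pi> b = \<rho> w"
    using lifts xy by metis
  have abH: "a \<in> carrier H" "b \<in> carrier H" using ab by (simp_all add: grp_center_def)
  \<comment> \<open>Since \<open>r\<close> fixes \<open>P\<close>, these pairs lie in the pullback,
    and their images in \<open>G\<close> have central lifts in \<open>H\<close>.\<close>
  have "(\<rho> z, z) \<otimes>\<^bsub>?L\<^esub> (\<rho> w, w) = (\<rho> w, w) \<otimes>\<^bsub>?L\<^esub> (\<rho> z, z)"
    using schur_cover_commute[OF G(1,2) H L finL abH center_commute[OF ab(1) abH(2)],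
      of "(\<rho> z, z)" "(\<rho> w, w)"] ab xy xyG zw r(2)
    by (simp add: fibre_product_simps)
  then show False using zw(3) by (simp add: fibre_product_simps)
qed

text \<open>Universality of both covers: commutation in \<open>H\<close> passes to the pullback of
  \<open>HP\<close> along the retraction, a central extension of \<open>G\<close>; commutation in
  \<open>HP\<close> passes to the preimage of \<open>P\<close> in \<open>H\<close>, a central
  extension of \<open>P\<close>.\<close>

lemma schur_covers_deep_commute_iff:
  fixes G :: "'a monoid" and H :: "'b monoid" and HP :: "'c monoid"
  assumes G: "group G" "finite (carrier G)" and H: "schur_cover G H \<pi>"
    and P: "subgroup P G" and HP: "schur_cover (G\<lparr>carrier := P\<rparr>) HP \<pi>P"
    and r: "r \<in> hom G (G\<lparr>carrier := P\<rparr>)" "\<forall>u \<in> P. r u = u"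
    and ab: "a \<in> carrier H" "b \<in> carrier H" and cd: "c \<in> carrier HP" "d \<in> carrier HP"
    and e: "\<pi> a = \<pi>P c" "\<pi> b = \<pi>P d"
  shows "a \<otimes>\<^bsub>H\<^esub> b = b \<otimes>\<^bsub>H\<^esub> a \<longleftrightarrow> c \<otimes>\<^bsub>HP\<^esub> d = d \<otimes>\<^bsub>HP\<^esub> c"
proof
  let ?P = "G\<lparr>carrier := P\<rparr>"
  interpret G: group G by (rule G(1))
  interpret P: group ?P using G.subgroup_imp_group[OF P] .
  have HPc: "central_extension ?P HP \<pi>P" using schur_cover_central[OF HP] .
  have Hc: "central_extension G H \<pi>" using schur_cover_central[OF H] .
  interpret H: group_hom H G \<pi> using central_extension_hom[OF G(1) Hc] .
  have fin: "finite (carrier H)" "finite (carrier HP)" "finite (carrier ?P)"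
    using H HP G(2) finite_subset[OF subgroup.subset[OF P]] by (simp_all add: schur_cover_def)
  have inP: "\<pi>P c \<in> P" "\<pi>P d \<in> P" using HPc cd unfolding central_extension_def by auto
  have inG: "\<pi>P c \<in> carrier G" "\<pi>P d \<in> carrier G" using inP P subgroup.subset by blast+
  {
    assume c: "a \<otimes>\<^bsub>H\<^esub> b = b \<otimes>\<^bsub>H\<^esub> a"
    have rh: "group_hom G ?P r"
      using r(1) G(1) P.is_group by (simp add: group_hom_def group_hom_axioms_def)
    let ?L = "fibre_product G HP r \<pi>P"
    have L: "central_extension G ?L fst" by (rule central_extension_pullback[OF G(1) rh HPc])
    have finL: "finite (carrier ?L)" by (rule fibre_product_finite[OF G(2) fin(2)])
    have "(\<pi>P c, c) \<otimes>\<^bsub>?L\<^esub> (\<pi>P d, d) = (\<pi>P d, d) \<otimes>\<^bsub>?L\<^esub> (\<pi>P c, c)"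
      using schur_cover_commute[OF G H L finL ab c, of "(\<pi>P c, c)" "(\<pi>P d, d)"] cd e inP inG r(2)
      by (simp add: fibre_product_simps)
    then show "c \<otimes>\<^bsub>HP\<^esub> d = d \<otimes>\<^bsub>HP\<^esub> c" by (simp add: fibre_product_simps)
  next
    assume c: "c \<otimes>\<^bsub>HP\<^esub> d = d \<otimes>\<^bsub>HP\<^esub> c"
    define U where "U = {h \<in> carrier H. \<pi> h \<in> P}"
    let ?L = "H\<lparr>carrier := U\<rparr>"
    have U: "subgroup U H"
    proof (rule H.G.subgroupI)
      have "\<one>\<^bsub>H\<^esub> \<in> U" unfolding U_def using subgroup.one_closed[OF P] by simp
      then show "U \<noteq> {}" by blast
    qed (use subgroup.m_closed[OF P] subgroup.m_inv_closed[OF P] in \<open>auto simp: U_def\<close>)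
    have "\<pi> ` U = P"
    proof
      show "P \<subseteq> \<pi> ` U"
      proof
        fix x assume x: "x \<in> P"
        then have "x \<in> \<pi> ` carrier H"
          using Hc subgroup.mem_carrier[OF P] by (simp add: central_extension_def)
        then show "x \<in> \<pi> ` U" using x unfolding U_def by blast
      qed
    qed (auto simp: U_def)
    moreover have "kernel ?L ?P \<pi> \<subseteq> grp_center ?L"
    proof
      fix z assume "z \<in> kernel ?L ?P \<pi>"
      then have "z \<in> U" "z \<in> kernel H G \<pi>" by (auto simp: kernel_def U_def)
      then show "z \<in> grp_center ?L"
        using Hc unfolding central_extension_def grp_center_def U_def by auto
    qed
    moreover have "\<pi> \<in> hom ?L ?P" by (auto simp: hom_def U_def)
    ultimately have L: "central_extension ?P ?L \<pi>"
      using H.G.subgroup_imp_group[OF U] by (simp add: central_extension_def)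
    have finL: "finite (carrier ?L)" using fin(1) by (simp add: U_def)
    have "a \<in> carrier ?L" "b \<in> carrier ?L" using ab e inP by (simp_all add: U_def)
    then show "a \<otimes>\<^bsub>H\<^esub> b = b \<otimes>\<^bsub>H\<^esub> a"
      using schur_cover_commute[OF P.is_group fin(3) HP L finL cd c, of a b] e by simp
  }
qed

section \<open>The two cases: several noncyclic Sylow subgroups, or exactly one\<close>

theorem theorem3p12:
  fixes G :: "'a monoid" and H :: "'b monoid" and \<pi> :: "'b \<Rightarrow> 'a"
  assumes "group G" and "finite (carrier G)" and "nilpotent_group G"
    and "\<not> cyclic_group G"
    and "schur_cover G H \<pi>"
  shows "(card {P. sylow_subgroup G P \<and> \<not> cyclic_group (G\<lparr>carrier := P\<rparr>)} \<ge> 2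
            \<longrightarrow> reduced_connected (carrier G) (deep_adj H \<pi>))
       \<and> (\<forall>P. {Q. sylow_subgroup G Q \<and> \<not> cyclic_group (G\<lparr>carrier := Q\<rparr>)} = {P} \<longrightarrow>
            (\<forall>(HP :: 'c monoid) (\<pi>P :: 'c \<Rightarrow> 'a). schur_cover (G\<lparr>carrier := P\<rparr>) HP \<pi>P \<longrightarrow>
               (reduced_connected (carrier G) (deep_adj H \<pi>) \<longleftrightarrow>
                reduced_connected P (deep_adj HP \<pi>P))))"
proof (intro conjI impI allI)
  note G = assms(1,2) nilpotent_coprime_commute[OF assms(3)] and H = assms(5)
  have ext: "central_extension G H \<pi>" using schur_cover_central[OF H] .
  interpret finite_cover H G \<pi>
    using central_extension_hom[OF G(1) ext] ext G H
    by (simp add: finite_cover_def finite_cover_axioms_def schur_cover_def)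
  have o0: "order G > 0" using G(2) H.order_gt_0_iff_finite by simp
  have sylow: "\<exists>p k m. Factorial_Ring.prime (p::nat) \<and> p dvd order G \<and> subgroup P G \<and> card P = p ^ k \<and>
      order G = p ^ k * m \<and> coprime p m" if P: "sylow_subgroup G P" for P
  proof -
    obtain p :: nat where p: "Factorial_Ring.prime p" "p dvd order G" "subgroup P G"
      "card P = p ^ multiplicity p (order G)" using P unfolding sylow_subgroup_def by blast
    obtain m where "order G = p ^ multiplicity p (order G) * m" "coprime p m"
      using prime_power_split[OF p(1) o0] by metis
    then show ?thesis using p by blast
  qed
  {
    let ?S = "{P. sylow_subgroup G P \<and> \<not> cyclic_group (G\<lparr>carrier := P\<rparr>)}"
    assume "card ?S \<ge> 2"
    then obtain P Q where PQ: "P \<in> ?S" "Q \<in> ?S" "P \<noteq> Q"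
      by (metis (no_types, lifting) card_le_Suc0_iff_eq card_eq_0_iff not_less_eq_eq numeral_2_eq_2 zero_le)
    obtain p k m where p: "Factorial_Ring.prime (p::nat)" "subgroup P G" "card P = p ^ k"
      "order G = p ^ k * m" "coprime p m" using sylow[of P] PQ(1) by blast
    obtain q l n where q: "Factorial_Ring.prime (q::nat)" "subgroup Q G" "card Q = q ^ l"
      "order G = q ^ l * n" "coprime q n" using sylow[of Q] PQ(2) by blast
    \<comment> \<open>For one prime, each Sylow subgroup contains all torsion of that prime, so two
      of them coincide.\<close>
    have "p \<noteq> q"
    proof
      assume pq: "p = q"
      have sub: "A \<subseteq> B" if A: "subgroup A G" "card A = p ^ i" and B: "subgroup B G" "card B = p ^ j"
        "order G = p ^ j * m'" "coprime p m'" for A B i j m'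
      proof
        fix x assume x: "x \<in> A"
        show "x \<in> B"
          using H.sylow_contains_torsion[OF G(2,3) p(1) B subgroup.mem_carrier[OF A(1) x], of i]
            H.subgroup_pow_card[OF A(1) x] A(2) by simp
      qed
      have "P \<subseteq> Q" using sub p(2,3) q(2-5) pq by blast
      moreover have "Q \<subseteq> P" using sub q(2,3) p(2-5) pq by blast
      ultimately show False using PQ(3) by blast
    qed
    moreover obtain u i where "u \<in> carrier H" "u \<notin> grp_center H" "u [^]\<^bsub>H\<^esub> (p ^ i) = \<one>\<^bsub>H\<^esub>"
      using noncyclic_sylow_torsion[OF G H p] PQ(1) by blast
    moreover obtain v j where "v \<in> carrier H" "v \<notin> grp_center H" "v [^]\<^bsub>H\<^esub> (q ^ j) = \<one>\<^bsub>H\<^esub>"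
      using noncyclic_sylow_torsion[OF G H q] PQ(2) by blast
    ultimately show "reduced_connected (carrier G) (deep_adj H \<pi>)"
      using reduced_connected_of_two_primes[OF p(1) q(1)] by blast
  }
  fix P and HP :: "'c monoid" and \<pi>P :: "'c \<Rightarrow> 'a"
  assume uniq: "{Q. sylow_subgroup G Q \<and> \<not> cyclic_group (G\<lparr>carrier := Q\<rparr>)} = {P}"
    and HP: "schur_cover (G\<lparr>carrier := P\<rparr>) HP \<pi>P"
  have sP: "sylow_subgroup G P" using uniq by blast
  obtain p k m where p: "Factorial_Ring.prime (p::nat)" "p dvd order G" and P: "subgroup P G" "card P = p ^ k"
    and o: "order G = p ^ k * m" "coprime p m" using sylow[OF sP] by blast
  \<comment> \<open>This tells \<open>P\<close> apart from Sylow subgroups of other primes by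
    order.\<close>
  have k0: "k > 0"
    using p o by (metis coprime_common_divisor_nat dvd_refl gr0I mult_1 not_prime_1 power_0)
  have "coprime (card P) m" using P(2) o(2) by simp
  then obtain r where r: "r \<in> hom G (G\<lparr>carrier := P\<rparr>)" "\<forall>u \<in> P. r u = u"
    "\<forall>g \<in> carrier G. \<exists>h \<in> carrier G. h [^]\<^bsub>G\<^esub> m = \<one>\<^bsub>G\<^esub> \<and> g = r g \<otimes>\<^bsub>G\<^esub> h"
    using H.exists_retraction[OF G(2,3) P(1), of m] o(1) P(2) by auto
  have rP: "r g \<in> P" if "g \<in> carrier G" for g using r(1) that by (auto simp: hom_def)
  have PG: "P \<subseteq> carrier G" using P(1) subgroup.subset by blast
  \<comment> \<open>A subgroup \<open>Q\<close> of full q-power order is cyclic: by uniqueness of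
    \<open>P\<close> if q divides the order of \<open>G\<close>, and because it is trivial
    otherwise. It contains all q-torsion of \<open>G\<close>, so
    \<open>torsion_central_of_cyclic\<close> applies.\<close>
  have qcentral: "u \<in> grp_center H" if q: "Factorial_Ring.prime (q::nat)" "q \<noteq> p"
    and u: "u \<in> carrier H" "u [^]\<^bsub>H\<^esub> (q ^ j) = \<one>\<^bsub>H\<^esub>" for q u j
  proof -
    obtain n where n: "order G = q ^ multiplicity q (order G) * n" "coprime q n"
      using prime_power_split[OF q(1) o0] by metis
    obtain Q where Q: "subgroup Q G" "card Q = q ^ multiplicity q (order G)"
      using sylow_thm[OF q(1) H.is_group n(1) G(2)] by blast
    have "cyclic_group (G\<lparr>carrier := Q\<rparr>)"
    proof (cases "q dvd order G")
      case True
      then have "sylow_subgroup G Q" using q(1) Q unfolding sylow_subgroup_def by blast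
      moreover have "Q \<noteq> P"
      proof
        assume "Q = P"
        then have "p ^ k = q ^ multiplicity q (order G)" using P(2) Q(2) by simp
        then have "p dvd q ^ multiplicity q (order G)" using k0 by (metis dvd_power)
        then show False using p(1) q by (metis prime_dvd_power primes_dvd_imp_eq)
      qed
      ultimately show ?thesis using uniq by blast
    next
      case False
      then have "card Q = 1" using Q(2) by (simp add: not_dvd_imp_multiplicity_0)
      then have "Q = {\<one>\<^bsub>G\<^esub>}" using subgroup.one_closed[OF Q(1)] by (metis card_1_singletonE singletonD)
      then show ?thesis
        using H.subgroup_imp_group[OF Q(1)] by (intro trivial_imp_cyclic_group) (simp add: trivial_group_def)
    qed
    then obtain t where t: "t \<in> Q" "Q = range (\<lambda>n::int. t [^]\<^bsub>G\<lparr>carrier := Q\<rparr>\<^esub> n)"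
      using group.cyclic_group[OF H.subgroup_imp_group[OF Q(1)]] by auto
    have "\<exists>i::int. x = t [^]\<^bsub>G\<^esub> i" if x: "x \<in> carrier G" "x [^]\<^bsub>G\<^esub> (q ^ n') = \<one>\<^bsub>G\<^esub>" for x n'
    proof -
      have "x \<in> Q" by (rule H.sylow_contains_torsion[OF G(2,3) q(1) Q n x])
      then show ?thesis using t H.int_pow_consistent[OF Q(1) t(1)] by auto
    qed
    then show ?thesis
      using torsion_central_of_cyclic[OF q(1) subgroup.mem_carrier[OF Q(1) t(1)] _ u] by blast
  qed
  \<comment> \<open>The power d^m is in the kernel, hence central. A p-power of \<open>d\<close> has
    exponent prime to \<open>p\<close>, so it is central by \<open>coprime_torsion_central\<close>.
    The two exponents are coprime.\<close>
  have central: "d \<in> grp_center H" if d: "d \<in> carrier H" "\<pi> d [^]\<^bsub>G\<^esub> m = \<one>\<^bsub>G\<^esub>" for d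
  proof -
    obtain i n where n: "order H = p ^ i * n" "coprime p n" using G.order_prime_split[OF finH p(1)] by metis
    have "(d [^]\<^bsub>H\<^esub> (p ^ i)) [^]\<^bsub>H\<^esub> n = \<one>\<^bsub>H\<^esub>"
      using G.pow_order_eq_1[OF d(1)] d(1) n(1) by (simp add: G.nat_pow_pow)
    then have "d [^]\<^bsub>H\<^esub> (p ^ i) \<in> grp_center H"
      using coprime_torsion_central[OF p(1) qcentral _ _ n(2)] d(1) by simp
    moreover have "d [^]\<^bsub>H\<^esub> m \<in> grp_center H"
      using kernel_central d by (simp add: hom_nat_pow)
    moreover have "coprime (p ^ i) m" using o(2) by simp
    ultimately show ?thesis using G.subgroup_coprime_pow[OF G.center_subgroup d(1)] by blast
  qed
  \<comment> \<open>The reflexive companion of adjacency for the cover \<open>HP\<close>, as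
    required by \<open>reduced_connected_retract\<close>.\<close>
  define D where "D x y \<longleftrightarrow> (\<forall>a \<in> carrier HP. \<forall>b \<in> carrier HP. \<pi>P a = x \<longrightarrow> \<pi>P b = y \<longrightarrow>
     a \<otimes>\<^bsub>HP\<^esub> b = b \<otimes>\<^bsub>HP\<^esub> a)" for x y
  have HPc: "central_extension (G\<lparr>carrier := P\<rparr>) HP \<pi>P" using schur_cover_central[OF HP] .
  then have surj: "\<pi>P ` carrier HP = P" by (simp add: central_extension_def)
  have CP: "commuting_lifts x y \<longleftrightarrow> D x y" if xy: "x \<in> P" "y \<in> P" for x y
  proof -
    obtain a b where ab: "a \<in> carrier H" "\<pi> a = x" "b \<in> carrier H" "\<pi> b = y"
      using lift xy PG by (metis subsetD)
    have "x \<in> \<pi>P ` carrier HP" "y \<in> \<pi>P ` carrier HP" using xy surj by simp_all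
    then obtain c d where cd: "c \<in> carrier HP" "\<pi>P c = x" "d \<in> carrier HP" "\<pi>P d = y" by blast
    have iff: "a \<otimes>\<^bsub>H\<^esub> b = b \<otimes>\<^bsub>H\<^esub> a \<longleftrightarrow> c' \<otimes>\<^bsub>HP\<^esub> d' = d' \<otimes>\<^bsub>HP\<^esub> c'"
      if "c' \<in> carrier HP" "d' \<in> carrier HP" "\<pi>P c' = x" "\<pi>P d' = y" for c' d'
      using schur_covers_deep_commute_iff[OF G(1,2) H P(1) HP r(1,2) ab(1,3) that(1,2)] ab that by simp
    have "D x y \<longleftrightarrow> a \<otimes>\<^bsub>H\<^esub> b = b \<otimes>\<^bsub>H\<^esub> a"
      unfolding D_def using iff cd by metis
    then show ?thesis using commuting_lifts_iff[OF ab(1,3)] ab by simp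
  qed
  \<comment> \<open>In x = r(x) h the factor h satisfies h^m = 1, so its lifts are central. Hence
    lifts of x and of r(x) agree modulo the centre and commute with the same elements.\<close>
  have CD: "commuting_lifts x y \<longleftrightarrow> D (r x) (r y)" if xy: "x \<in> carrier G" "y \<in> carrier G" for x y
  proof -
    have dec: "\<exists>a \<in> carrier H. \<exists>c \<in> carrier H. \<pi> a = x \<and> \<pi> c = r x \<and>
        inv\<^bsub>H\<^esub> a \<otimes>\<^bsub>H\<^esub> c \<in> grp_center H \<and> inv\<^bsub>H\<^esub> c \<otimes>\<^bsub>H\<^esub> a \<in> grp_center H"
      if x: "x \<in> carrier G" for x
    proof -
      obtain h where h: "h \<in> carrier G" "h [^]\<^bsub>G\<^esub> m = \<one>\<^bsub>G\<^esub>" "x = r x \<otimes>\<^bsub>G\<^esub> h" using r(3) x by blast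
      obtain c d where cd: "c \<in> carrier H" "\<pi> c = r x" "d \<in> carrier H" "\<pi> d = h"
        using lift h(1) rP[OF x] PG by (metis subsetD)
      have dc: "d \<in> grp_center H" using central cd h(2) by simp
      have "\<pi> (c \<otimes>\<^bsub>H\<^esub> d) = x" using cd h(3) by simp
      moreover have "inv\<^bsub>H\<^esub> c \<otimes>\<^bsub>H\<^esub> (c \<otimes>\<^bsub>H\<^esub> d) = d" using cd by (simp flip: G.m_assoc)
      moreover have "inv\<^bsub>H\<^esub> (c \<otimes>\<^bsub>H\<^esub> d) \<otimes>\<^bsub>H\<^esub> c = inv\<^bsub>H\<^esub> d"
        using cd by (simp add: G.inv_mult_group G.m_assoc)
      ultimately show ?thesis
        using cd dc subgroup.m_inv_closed[OF G.center_subgroup dc]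
        by (intro bexI[of _ "c \<otimes>\<^bsub>H\<^esub> d"] bexI[of _ c]) simp_all
    qed
    obtain a c where ac: "a \<in> carrier H" "c \<in> carrier H" "\<pi> a = x" "\<pi> c = r x"
      "inv\<^bsub>H\<^esub> a \<otimes>\<^bsub>H\<^esub> c \<in> grp_center H" "inv\<^bsub>H\<^esub> c \<otimes>\<^bsub>H\<^esub> a \<in> grp_center H" using dec[OF xy(1)] by blast
    obtain b d where bd: "b \<in> carrier H" "d \<in> carrier H" "\<pi> b = y" "\<pi> d = r y"
      "inv\<^bsub>H\<^esub> b \<otimes>\<^bsub>H\<^esub> d \<in> grp_center H" "inv\<^bsub>H\<^esub> d \<otimes>\<^bsub>H\<^esub> b \<in> grp_center H" using dec[OF xy(2)] by blast
    have "a \<otimes>\<^bsub>H\<^esub> b = b \<otimes>\<^bsub>H\<^esub> a \<longleftrightarrow> c \<otimes>\<^bsub>H\<^esub> d = d \<otimes>\<^bsub>H\<^esub> c"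
    proof
      assume "a \<otimes>\<^bsub>H\<^esub> b = b \<otimes>\<^bsub>H\<^esub> a"
      then have "c \<otimes>\<^bsub>H\<^esub> b = b \<otimes>\<^bsub>H\<^esub> c" by (rule commute_cong_left[OF ac(1,2,5) bd(1)])
      then show "c \<otimes>\<^bsub>H\<^esub> d = d \<otimes>\<^bsub>H\<^esub> c" using commute_cong_left[OF bd(1,2,5) ac(2)] by simp
    next
      assume "c \<otimes>\<^bsub>H\<^esub> d = d \<otimes>\<^bsub>H\<^esub> c"
      then have "a \<otimes>\<^bsub>H\<^esub> d = d \<otimes>\<^bsub>H\<^esub> a" by (rule commute_cong_left[OF ac(2,1,6) bd(2)])
      then show "a \<otimes>\<^bsub>H\<^esub> b = b \<otimes>\<^bsub>H\<^esub> a" using commute_cong_left[OF bd(2,1,6) ac(1)] by simp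
    qed
    then have "commuting_lifts x y \<longleftrightarrow> commuting_lifts (r x) (r y)"
      using commuting_lifts_iff[OF ac(1) bd(1)] commuting_lifts_iff[OF ac(2) bd(2)] ac bd by simp
    then show ?thesis using CP rP xy by simp
  qed
  have Drefl: "D x x" for x
  proof (cases "x \<in> P")
    case True
    then show ?thesis using CP[OF True True] commuting_lifts_refl by blast
  next
    case False
    \<comment> \<open>No element of \<open>HP\<close> lies over \<open>x\<close>, so the condition
      holds vacuously.\<close>
    then show ?thesis using surj unfolding D_def by blast
  qed
  show "reduced_connected (carrier G) (deep_adj H \<pi>) \<longleftrightarrow> reduced_connected P (deep_adj HP \<pi>P)"
  proof (rule reduced_connected_retract[where r = r and C = commuting_lifts and D = D])
    show "deep_adj HP \<pi>P x y \<longleftrightarrow> x \<noteq> y \<and> D x y" for x y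
      unfolding deep_adj_def D_def by blast
  qed (use PG rP r(2) CD Drefl deep_adj_iff in auto)
qed

end
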